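(* For a (complex) Banach space $X$ and $2\leq q<\infty$ the following statements are equivalent: (a) $X$ has cotype $q$; (b) there exists $C>0$ such that for every $m\in\mathbb{N}$ and every finite family $(x_\alpha)_{|\alpha|\le m}$ in $X$ (indexed by multi-indices $\alpha\in\mathbb{N}_0^n$ with $|\alpha|\le m$, for any number $n$ of variables) \[ \Big(\sum_{|\alpha|\le m}\|x_\alpha\|^q\Big)^{1/q}\leq C^m\Big(\int_{\mathbb{T}^n}\Big\|\sum_{|\alpha|\le m}x_\alpha z^\alpha\Big\|^q dz\Big)^{1/q}; \] (c) there exists $C>0$ such that for every $m\in\mathbb{N}$ and every finite family $\{x_A:|A|\le m\}\subset X$ (indexed by finite sets $A\subset\mathbb{N}$ with $|A|\le m$) we have \[ \Big(\sum_A\|x_A\|^q\Big)^{1/q}\leq C^m\Big(\mathbb{E}\Big\|\sum_A x_A\varepsilon_A\Big\|^q\Big)^{1/q}. \]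
   Context: $X$ has cotype $q$ ($2\le q<\infty$) if there is a constant $C\geq1$ such that for every $N\in\mathbb{N}$ and all $x_1,\dots,x_N\in X$ \[ \Big(\sum_{n=1}^N\|x_n\|^q\Big)^{1/q}\leq C\Big(\int_{\mathbb{T}^N}\Big\|\sum_{n=1}^Nx_nz_n\Big\|^qdz\Big)^{1/q}. \] $\mathbb{T}$ is the unit circle in $\mathbb{C}$ and $dz$ denotes the normalized (product) Lebesgue measure. For a multi-index $\alpha=(\alpha_1,\dots,\alpha_n)$ of nonnegative integers, $|\alpha|=\alpha_1+\cdots+\alpha_n$ and $z^\alpha=z_1^{\alpha_1}\cdots z_n^{\alpha_n}$. $\{-1,1\}^\infty$ carries the infinite product of the uniform probability $(\delta_1+\delta_{-1})/2$, $\mathbb{E}$ is the expectation in $\varepsilon=(\varepsilon_n)_n\in\{-1,1\}^\infty$, and $\varepsilon_A=\prod_{n\in A}\varepsilon_n$ for finite $A\subset\mathbb{N}$ ($\varepsilon_\varnothing=1$). *)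

theory Defs
  imports "HOL-Probability.Probability"
begin

class complex_banach = banach +
  fixes scaleC :: "complex \<Rightarrow> 'a \<Rightarrow> 'a"  (infixr \<open>*\<^sub>C\<close> 75)
  assumes scaleC_add_right: "a *\<^sub>C (x + y) = a *\<^sub>C x + a *\<^sub>C y"
    and scaleC_add_left: "(a + b) *\<^sub>C x = a *\<^sub>C x + b *\<^sub>C x"
    and scaleC_scaleC: "a *\<^sub>C (b *\<^sub>C x) = (a * b) *\<^sub>C x"
    and scaleC_one: "1 *\<^sub>C x = x"
    and scaleR_scaleC: "r *\<^sub>R x = complex_of_real r *\<^sub>C x"
    and norm_scaleC: "norm (a *\<^sub>C x) = cmod a * norm x"

instantiation complex :: complex_banach
begin

definition scaleC_complex :: "complex \<Rightarrow> complex \<Rightarrow> complex" where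
  "scaleC_complex a x = a * x"

instance
  by standard (simp_all add: scaleC_complex_def algebra_simps norm_mult scaleR_conv_of_real)

end

text \<open>Pushing the uniform distribution on \<open>[0, 2\<pi>]\<close> forward along \<open>cis\<close> gives normalized
  arc length. The coordinates of the \<open>n\<close>-torus are indexed by \<open>0, \<dots>, n - 1\<close>.\<close>

definition circle_measure :: "complex measure" where
  "circle_measure =
     distr (uniform_measure lborel {0..2 * pi}) (restrict_space borel (sphere 0 1)) cis"

definition torus_measure :: "nat \<Rightarrow> (nat \<Rightarrow> complex) measure" where
  "torus_measure n = (\<Pi>\<^sub>M i\<in>{..<n}. circle_measure)"

definition sign_measure :: "(nat \<Rightarrow> real) measure" where
  "sign_measure = (\<Pi>\<^sub>M i\<in>UNIV. uniform_count_measure {-1, 1})"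

definition cotype :: "real \<Rightarrow> 'a::complex_banach itself \<Rightarrow> bool" where
  "cotype q (_ :: 'a itself) \<longleftrightarrow>
     (\<exists>C\<ge>1. \<forall>N. \<forall>x :: nat \<Rightarrow> 'a.
        (\<Sum>k<N. norm (x k) powr q) powr (1 / q)
          \<le> C * (\<integral>z. norm (\<Sum>k<N. z k *\<^sub>C x k) powr q \<partial>torus_measure N) powr (1 / q))"

text \<open>An \<open>n\<close>-tuple of natural numbers is encoded as a sequence vanishing from position \<open>n\<close> on.\<close>

definition multi_indices :: "nat \<Rightarrow> nat \<Rightarrow> (nat \<Rightarrow> nat) set" where
  "multi_indices n m = {\<alpha>. (\<forall>i\<ge>n. \<alpha> i = 0) \<and> (\<Sum>i<n. \<alpha> i) \<le> m}"

lemma finite_multi_indices: "finite (multi_indices n m)"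
proof (rule finite_subset)
  show "multi_indices n m \<subseteq> {\<alpha>. \<forall>i. (i \<in> {..<n} \<longrightarrow> \<alpha> i \<in> {..m}) \<and> (i \<notin> {..<n} \<longrightarrow> \<alpha> i = 0)}"
    by (auto simp: multi_indices_def intro: order_trans[OF member_le_sum])
  show "finite {\<alpha> :: nat \<Rightarrow> nat.
      \<forall>i. (i \<in> {..<n} \<longrightarrow> \<alpha> i \<in> {..m}) \<and> (i \<notin> {..<n} \<longrightarrow> \<alpha> i = 0)}"
    by (rule finite_set_of_finite_funs) simp_all
qed

definition monomial_at :: "nat \<Rightarrow> (nat \<Rightarrow> nat) \<Rightarrow> (nat \<Rightarrow> complex) \<Rightarrow> complex" where
  "monomial_at n \<alpha> z = (\<Prod>i<n. z i ^ \<alpha> i)"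

end

theory Submission
  imports Defs
begin

text \<open>
  The implications run from (a) to (c) to (b) to (a). For the first one, cotype \<open>q\<close> is transferred to
  signs by rotating the torus by \<open>\<epsilon>\<close> and contracting. In a Walsh polynomial of degree at most \<open>m\<close> the
  part of degree \<open>k\<close> is isolated by a signed combination of dilations with nodes \<open>j / m\<close> and total
  mass at most \<open>12 ^ m\<close>. Colouring the variables with \<open>k\<close> colours and averaging over one sign per colour
  keeps exactly the sets that meet every colour once; on these the cotype inequality is iterated \<open>k\<close>
  times, and a random colouring captures a given set with probability \<open>k! / k ^ k \<ge> 3 ^ (-k)\<close>. For the
  second one, convolving a polynomial on the torus with a positive kernel that depends on signs
  \<open>\<epsilon>(i, l)\<close> turns \<open>z ^ \<alpha>\<close> into a multiple, by at least \<open>4 ^ (-m)\<close>, of \<open>z ^ \<alpha>\<close> times the Walsh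
  function of the set of all \<open>(i, \<alpha> i)\<close> with \<open>\<alpha> i \<noteq> 0\<close>. The third one is the case \<open>m = 1\<close>.
\<close>

section \<open>Weighted Jensen inequality and averages over sign vectors\<close>

text \<open>Every loss has to be geometric in \<open>m\<close>, and this dictates the tools. Cotype
  only controls sums that are linear in the signs, so a homogeneous part of degree \<open>k\<close>
  must become linear in each of \<open>k\<close> separate groups of signs before the inequality can
  be iterated. Colouring does this without altering coefficients. The bound
  \<open>k ^ k \<le> 3 ^ k * k!\<close> serves twice, for the colouring probability and for the
  Lagrange weights of equally spaced nodes. On the torus the obstacle is that a variable may occur
  with many exponents, whereas a sign squares to one. Hence every exponent of every variable gets a
  sign of its own, and a monomial uses at most as many signs as its degree, since exponent zero gets
  none. In the kernel the sign of exponent \<open>l\<close> has weight \<open>1 / 2 ^ l\<close>: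
  summable, which keeps the kernel positive, and geometric, which bounds the product over the
  variables below by a geometric factor in the total degree. Convolving over roots of unity instead
  of the circle keeps averages of vectors finite, so that integrals are only taken of real
  functions.\<close>

lemma convex_on_powr_nonneg:
  fixes q :: real
  assumes "1 \<le> q"
  shows "convex_on {0..} (\<lambda>x. x powr q)"
proof (rule convex_onI)
  fix t x y :: real
  assume t: "0 < t" "t < 1" and xy: "x \<in> {0..}" "y \<in> {0..}"
  have le: "s powr q \<le> s" if "0 < s" "s < 1" for s :: real
    using powr_mono'[of 1 q s] that assms by simp
  consider "x = 0" | "y = 0" | "0 < x" "0 < y"
    using xy by force
  then show "((1 - t) *\<^sub>R x + t *\<^sub>R y) powr q \<le> (1 - t) * x powr q + t * y powr q"
  proof cases
    case 1
    then show ?thesis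
      using t xy assms le[of t] by (auto simp: powr_mult intro!: mult_right_mono)
  next
    case 2
    then show ?thesis
      using t xy assms le[of "1 - t"] by (auto simp: powr_mult intro!: mult_right_mono)
  next
    case 3
    then show ?thesis
      using powr_convex[OF assms] t by (auto simp: convex_on_def)
  qed
qed simp

text \<open>Jensen for the weights \<open>\<bar>w j\<bar>\<close> divided by their total mass.
  Signed weights are allowed because the filters below have them; the positive kernels have total
  mass one and lose nothing.\<close>

lemma norm_weighted_sum_powr_le:
  fixes v :: "'j \<Rightarrow> 'a::real_normed_vector" and q :: real
  assumes J: "finite J" and q: "1 \<le> q"
  shows "norm (\<Sum>j\<in>J. w j *\<^sub>R v j) powr q
    \<le> (\<Sum>j\<in>J. \<bar>w j\<bar>) powr (q - 1) * (\<Sum>j\<in>J. \<bar>w j\<bar> * norm (v j) powr q)"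
proof (cases "(\<Sum>j\<in>J. \<bar>w j\<bar>) = 0")
  case True
  then have "w j = 0" if "j \<in> J" for j
    using that J by (simp add: sum_nonneg_eq_0_iff)
  then show ?thesis by simp
next
  case False
  define W where "W = (\<Sum>j\<in>J. \<bar>w j\<bar>)"
  have W: "W > 0"
    using False by (simp add: W_def order.not_eq_order_implies_strict sum_nonneg)
  have nonempty: "J \<noteq> {}" using False by auto
  have "norm (\<Sum>j\<in>J. w j *\<^sub>R v j) \<le> (\<Sum>j\<in>J. \<bar>w j\<bar> * norm (v j))"
    by (rule order_trans[OF norm_sum]) simp
  also have "\<dots> = W * (\<Sum>j\<in>J. (\<bar>w j\<bar> / W) *\<^sub>R norm (v j))"
    using W by (simp add: sum_distrib_left)
  finally have "norm (\<Sum>j\<in>J. w j *\<^sub>R v j) powr q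
      \<le> (W * (\<Sum>j\<in>J. (\<bar>w j\<bar> / W) *\<^sub>R norm (v j))) powr q"
    using q by (intro powr_mono2) auto
  also have "\<dots> = W powr q * (\<Sum>j\<in>J. (\<bar>w j\<bar> / W) *\<^sub>R norm (v j)) powr q"
    using W by (intro powr_mult) 
  also have "\<dots> \<le> W powr q * (\<Sum>j\<in>J. (\<bar>w j\<bar> / W) * norm (v j) powr q)"
    using W J nonempty q
    by (intro mult_left_mono convex_on_sum[OF _ _ convex_on_powr_nonneg])
       (auto simp: W_def simp flip: sum_divide_distrib)
  also have "\<dots> = W powr (q - 1) * (\<Sum>j\<in>J. \<bar>w j\<bar> * norm (v j) powr q)"
    using W by (simp add: sum_distrib_left powr_diff mult_ac)
  finally show ?thesis by (simp add: W_def)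
qed

text \<open>Fixing the value \<open>1\<close> from position \<open>N\<close> on makes the cube
  finite and closed under pointwise multiplication while sign vectors stay total functions, so the
  same Walsh products serve here and on the infinite product.\<close>

definition signs :: "nat \<Rightarrow> (nat \<Rightarrow> real) set" where
  "signs N = PiE_dflt {..<N} 1 (\<lambda>_. {-1, 1})"

definition sign_avg :: "nat \<Rightarrow> ((nat \<Rightarrow> real) \<Rightarrow> real) \<Rightarrow> real" where
  "sign_avg N g = (\<Sum>\<epsilon>\<in>signs N. g \<epsilon>) / 2 ^ N"

lemma finite_signs [simp]: "finite (signs N)"
  by (auto simp: signs_def)

lemma card_signs [simp]: "card (signs N) = 2 ^ N"
  unfolding signs_def by (subst card_PiE_dflt) (auto simp: numeral_2_eq_2)

lemma signs_iff: "\<epsilon> \<in> signs N \<longleftrightarrow> (\<forall>i<N. \<epsilon> i = -1 \<or> \<epsilon> i = 1) \<and> (\<forall>i\<ge>N. \<epsilon> i = 1)"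
  by (simp add: signs_def PiE_dflt_def not_less all_conj_distrib)

lemma signs_abs [simp]: "\<epsilon> \<in> signs N \<Longrightarrow> \<bar>\<epsilon> i\<bar> = 1"
  by (cases "i < N") (auto simp: signs_iff)

lemma signs_square [simp]: "\<epsilon> \<in> signs N \<Longrightarrow> \<epsilon> i * \<epsilon> i = 1"
  by (cases "i < N") (auto simp: signs_iff)

lemma signs_mult: "\<epsilon> \<in> signs N \<Longrightarrow> \<eta> \<in> signs N \<Longrightarrow> (\<lambda>i. \<eta> i * \<epsilon> i) \<in> signs N"
  unfolding signs_iff by (metis minus_minus mult.right_neutral mult_minus1_right)

lemma sign_avg_mono: "(\<And>\<epsilon>. \<epsilon> \<in> signs N \<Longrightarrow> f \<epsilon> \<le> g \<epsilon>) \<Longrightarrow> sign_avg N f \<le> sign_avg N g"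
  unfolding sign_avg_def by (intro divide_right_mono sum_mono) auto

lemma sign_avg_cong: "(\<And>\<epsilon>. \<epsilon> \<in> signs N \<Longrightarrow> f \<epsilon> = g \<epsilon>) \<Longrightarrow> sign_avg N f = sign_avg N g"
  unfolding sign_avg_def by (metis (mono_tags, lifting) sum.cong)

lemma sign_avg_const [simp]: "sign_avg N (\<lambda>_. a) = a"
  by (simp add: sign_avg_def)

lemma sign_avg_nonneg: "(\<And>\<epsilon>. \<epsilon> \<in> signs N \<Longrightarrow> 0 \<le> f \<epsilon>) \<Longrightarrow> 0 \<le> sign_avg N f"
  unfolding sign_avg_def by (simp add: sum_nonneg)

lemma sign_avg_cmult: "sign_avg N (\<lambda>\<epsilon>. a * f \<epsilon>) = a * sign_avg N f"
  by (simp add: sign_avg_def sum_distrib_left)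

lemma sign_avg_sum: "sign_avg N (\<lambda>\<epsilon>. \<Sum>j\<in>J. f j \<epsilon>) = (\<Sum>j\<in>J. sign_avg N (f j))"
  unfolding sign_avg_def by (subst sum.swap) (simp add: sum_divide_distrib)

lemma sign_avg_swap: "sign_avg N (\<lambda>\<epsilon>. sign_avg M (\<lambda>\<eta>. f \<epsilon> \<eta>)) = sign_avg M (\<lambda>\<eta>. sign_avg N (\<lambda>\<epsilon>. f \<epsilon> \<eta>))"
  unfolding sign_avg_def by (simp flip: sum_divide_distrib) (subst sum.swap, simp)

text \<open>Multiplication by \<open>\<eta>\<close> is an involution of the finite cube. This is the
  invariance behind the sign changes below.\<close>

lemma sign_avg_mult_sign:
  assumes "\<eta> \<in> signs N"
  shows "sign_avg N (\<lambda>\<epsilon>. g (\<lambda>i. \<eta> i * \<epsilon> i)) = sign_avg N g"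
proof -
  have [simp]: "\<eta> i * (\<eta> i * a) = a" for i a
    using signs_square[OF assms, of i] by (simp flip: mult.assoc)
  show ?thesis
    unfolding sign_avg_def
    using assms
    by (intro arg_cong2[where f = "(/)"] refl
        sum.reindex_bij_witness[of _ "\<lambda>\<epsilon> i. \<eta> i * \<epsilon> i" "\<lambda>\<epsilon> i. \<eta> i * \<epsilon> i"])
       (auto intro: signs_mult)
qed

text \<open>Exchanges the default value \<open>1\<close> for \<open>undefined\<close>: the
  extensional form is the one to which \<open>prod_sum_PiE\<close> and the finite product measure
  apply.\<close>

lemma signs_reindex_PiE:
  "(\<Sum>\<epsilon>\<in>signs N. f \<epsilon>) = (\<Sum>h\<in>PiE {..<N} (\<lambda>_. {-1, 1}). f (\<lambda>i. if i < N then h i else 1))"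
proof -
  have "signs N = (\<lambda>h i. if i \<in> {..<N} then h i else 1) ` PiE {..<N} (\<lambda>_. {-1, 1})"
    unfolding signs_def by (rule dflt_image_PiE[symmetric])
  moreover have "inj_on (\<lambda>h i. if i \<in> {..<N} then h i else (1::real)) (PiE {..<N} (\<lambda>_. {-1, 1}))"
  proof (rule inj_onI, rule PiE_ext)
    fix g h :: "nat \<Rightarrow> real" and i
    assume "(\<lambda>i. if i \<in> {..<N} then g i else 1) = (\<lambda>i. if i \<in> {..<N} then h i else 1)"
      and "i \<in> {..<N}"
    then show "g i = h i"
      by (metis (mono_tags, lifting))
  qed
  ultimately show ?thesis
    by (simp add: sum.reindex o_def)
qed

lemma sign_avg_prod:
  "sign_avg N (\<lambda>\<epsilon>. \<Prod>i<N. h i (\<epsilon> i)) = (\<Prod>i<N. (h i (-1) + h i 1) / 2)"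
proof -
  have "(\<Sum>\<epsilon>\<in>signs N. \<Prod>i<N. h i (\<epsilon> i)) = (\<Prod>i<N. \<Sum>y\<in>{-1, 1}. h i y)"
    unfolding signs_reindex_PiE by (subst prod_sum_PiE) auto
  then show ?thesis
    by (simp add: sign_avg_def prod_dividef)
qed

section \<open>Multipliers acting on Walsh polynomials\<close>

text \<open>A multiplier of product form acts by replacing each \<open>\<epsilon> i\<close> with
  \<open>\<rho> j i * \<epsilon> i\<close>, so a signed combination of such multipliers costs only
  the total mass of its weights. Sign changes as \<open>\<rho>\<close> give contraction; dilations
  combined with sign changes give the decoupling filter.\<close>

lemma sign_avg_multiplier_le:
  fixes x :: "nat set \<Rightarrow> 'a::real_normed_vector" and q :: real
  assumes q: "1 \<le> q" and J: "finite J"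
    and E: "\<And>j. j \<in> J \<Longrightarrow>
      sign_avg N (\<lambda>\<epsilon>. norm (\<Sum>A\<in>F. (\<Prod>i\<in>A. \<rho> j i * \<epsilon> i) *\<^sub>R x A) powr q) \<le> E"
  shows "sign_avg N (\<lambda>\<epsilon>. norm (\<Sum>A\<in>F. ((\<Sum>j\<in>J. w j * (\<Prod>i\<in>A. \<rho> j i)) * (\<Prod>i\<in>A. \<epsilon> i)) *\<^sub>R x A) powr q)
    \<le> (\<Sum>j\<in>J. \<bar>w j\<bar>) powr q * E"
proof (cases "(\<Sum>j\<in>J. \<bar>w j\<bar>) = 0")
  case True
  then have "w j = 0" if "j \<in> J" for j
    using that J by (simp add: sum_nonneg_eq_0_iff)
  then show ?thesis using q by simp
next
  case False
  define W where "W = (\<Sum>j\<in>J. \<bar>w j\<bar>)"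
  have W: "W > 0"
    using False by (simp add: W_def order.not_eq_order_implies_strict sum_nonneg)
  have eq: "(\<Sum>A\<in>F. ((\<Sum>j\<in>J. w j * (\<Prod>i\<in>A. \<rho> j i)) * (\<Prod>i\<in>A. \<epsilon> i)) *\<^sub>R x A)
      = (\<Sum>j\<in>J. w j *\<^sub>R (\<Sum>A\<in>F. (\<Prod>i\<in>A. \<rho> j i * \<epsilon> i) *\<^sub>R x A))" for \<epsilon>
    by (simp add: scaleR_sum_right sum_distrib_right scaleR_sum_left prod.distrib mult.assoc)
       (rule sum.swap)
  have "sign_avg N (\<lambda>\<epsilon>. norm (\<Sum>A\<in>F. ((\<Sum>j\<in>J. w j * (\<Prod>i\<in>A. \<rho> j i)) * (\<Prod>i\<in>A. \<epsilon> i)) *\<^sub>R x A) powr q)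
      \<le> sign_avg N (\<lambda>\<epsilon>. W powr (q - 1) *
          (\<Sum>j\<in>J. \<bar>w j\<bar> * norm (\<Sum>A\<in>F. (\<Prod>i\<in>A. \<rho> j i * \<epsilon> i) *\<^sub>R x A) powr q))"
    unfolding eq W_def by (intro sign_avg_mono norm_weighted_sum_powr_le J q)
  also have "\<dots> = W powr (q - 1) *
      (\<Sum>j\<in>J. \<bar>w j\<bar> * sign_avg N (\<lambda>\<epsilon>. norm (\<Sum>A\<in>F. (\<Prod>i\<in>A. \<rho> j i * \<epsilon> i) *\<^sub>R x A) powr q))"
    by (simp add: sign_avg_cmult sign_avg_sum)
  also have "\<dots> \<le> W powr (q - 1) * (\<Sum>j\<in>J. \<bar>w j\<bar> * E)"
    using E by (intro mult_left_mono sum_mono) auto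
  also have "\<dots> = W powr q * E"
    using W by (simp add: W_def powr_diff flip: sum_distrib_right)
  finally show ?thesis by (simp add: W_def)
qed

text \<open>The positive Riesz kernel \<open>\<Prod>i<N. 1 + \<rho> i * \<eta> i\<close> has mean one and turns \<open>\<epsilon>\<close> into \<open>\<rho> * \<epsilon>\<close>.\<close>

lemma sign_avg_contraction:
  fixes x :: "nat set \<Rightarrow> 'a::real_normed_vector" and q :: real
  assumes q: "1 \<le> q" and F: "\<And>A. A \<in> F \<Longrightarrow> A \<subseteq> {..<N}" and \<rho>: "\<And>i. \<bar>\<rho> i\<bar> \<le> 1"
  shows "sign_avg N (\<lambda>\<epsilon>. norm (\<Sum>A\<in>F. (\<Prod>i\<in>A. \<rho> i * \<epsilon> i) *\<^sub>R x A) powr q)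
    \<le> sign_avg N (\<lambda>\<epsilon>. norm (\<Sum>A\<in>F. (\<Prod>i\<in>A. \<epsilon> i) *\<^sub>R x A) powr q)"
proof -
  define w where "w \<eta> = (\<Prod>i<N. 1 + \<rho> i * \<eta> i) / 2 ^ N" for \<eta> :: "nat \<Rightarrow> real"
  have coeff: "(\<Sum>\<eta>\<in>signs N. w \<eta> * (\<Prod>i\<in>A. \<eta> i)) = (\<Prod>i\<in>A. \<rho> i)" if "A \<subseteq> {..<N}" for A
  proof -
    have restrict: "(\<Prod>i\<in>A. h i) = (\<Prod>i<N. if i \<in> A then h i else 1)" for h :: "nat \<Rightarrow> real"
      using that by (subst prod.inter_restrict[symmetric]) (auto simp: Int_absorb1)
    have "(\<Sum>\<eta>\<in>signs N. w \<eta> * (\<Prod>i\<in>A. \<eta> i))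
        = sign_avg N (\<lambda>\<eta>. \<Prod>i<N. (1 + \<rho> i * \<eta> i) * (if i \<in> A then \<eta> i else 1))"
      by (simp add: w_def sign_avg_def sum_divide_distrib restrict prod.distrib)
    also have "\<dots> = (\<Prod>i<N. if i \<in> A then \<rho> i else 1)"
      using sign_avg_prod[of N "\<lambda>i s. (1 + \<rho> i * s) * (if i \<in> A then s else 1)"]
      by (simp add: field_simps cong: if_cong) (rule prod.cong, auto)
    also have "\<dots> = (\<Prod>i\<in>A. \<rho> i)"
      by (simp add: restrict)
    finally show ?thesis .
  qed
  have nonneg: "0 \<le> w \<eta>" if "\<eta> \<in> signs N" for \<eta>
  proof -
    have "\<bar>\<rho> i * \<eta> i\<bar> \<le> 1" for i
      using \<rho>[of i] that by (simp add: abs_mult)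
    then have "0 \<le> 1 + \<rho> i * \<eta> i" for i
      by (smt (verit))
    then show ?thesis
      by (simp add: w_def prod_nonneg)
  qed
  have total: "(\<Sum>\<eta>\<in>signs N. \<bar>w \<eta>\<bar>) = 1"
    using coeff[of "{}"] nonneg by simp
  have "sign_avg N (\<lambda>\<epsilon>. norm (\<Sum>A\<in>F. (\<Prod>i\<in>A. \<rho> i * \<epsilon> i) *\<^sub>R x A) powr q)
      = sign_avg N (\<lambda>\<epsilon>. norm (\<Sum>A\<in>F. ((\<Sum>\<eta>\<in>signs N. w \<eta> * (\<Prod>i\<in>A. \<eta> i)) * (\<Prod>i\<in>A. \<epsilon> i)) *\<^sub>R x A) powr q)"
    by (simp add: coeff F prod.distrib)
  also have "\<dots> \<le> (\<Sum>\<eta>\<in>signs N. \<bar>w \<eta>\<bar>) powr q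
      * sign_avg N (\<lambda>\<epsilon>. norm (\<Sum>A\<in>F. (\<Prod>i\<in>A. \<epsilon> i) *\<^sub>R x A) powr q)"
    by (intro sign_avg_multiplier_le q finite_signs eq_refl
        sign_avg_mult_sign[where g = "\<lambda>\<epsilon>. norm (\<Sum>A\<in>F. (\<Prod>i\<in>A. \<epsilon> i) *\<^sub>R x A) powr q"])
  finally show ?thesis
    by (simp add: total)
qed

section \<open>Weights extracting one coefficient of a polynomial\<close>

text \<open>Numerator of a Lagrange polynomial: each linear factor combines two neighbouring
  coefficients with weights of modulus at most one, so the bound doubles.\<close>

lemma abs_coeff_prod_linear_le:
  fixes t :: "'i \<Rightarrow> real"
  assumes "finite S" "\<And>i. i \<in> S \<Longrightarrow> \<bar>t i\<bar> \<le> 1"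
  shows "\<bar>coeff (\<Prod>i\<in>S. [:- t i, 1:]) k\<bar> \<le> 2 ^ card S"
  using assms
proof (induction S arbitrary: k rule: finite_induct)
  case empty
  then show ?case by (cases k) auto
next
  case (insert a S)
  let ?p = "\<Prod>i\<in>S. [:- t i, 1:]"
  have IH: "\<bar>coeff ?p j\<bar> \<le> 2 ^ card S" for j
    using insert by auto
  have "\<bar>coeff (\<Prod>i\<in>insert a S. [:- t i, 1:]) k\<bar> = \<bar>- t a * coeff ?p k + coeff (pCons 0 ?p) k\<bar>"
    using insert by simp
  also have "\<dots> \<le> \<bar>t a\<bar> * \<bar>coeff ?p k\<bar> + \<bar>coeff (pCons 0 ?p) k\<bar>"
    by (simp add: abs_mult order_trans[OF abs_triangle_ineq4])
  also have "\<dots> \<le> 1 * 2 ^ card S + 2 ^ card S"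
    using insert.prems IH by (intro add_mono mult_mono) (auto simp: coeff_pCons split: nat.split)
  finally show ?case
    using insert.hyps by simp
qed

text \<open>Denominator of a Lagrange polynomial for equally spaced nodes. The nodes below
  \<open>j\<close> contribute \<open>j!\<close> and those above it \<open>(m - j)!\<close>, which
  later combine with \<open>m!\<close> to a binomial coefficient.\<close>

lemma prod_abs_diff_eq_fact:
  assumes "j \<le> m"
  shows "(\<Prod>i\<in>{..m} - {j}. \<bar>real j - real i\<bar>) = fact j * fact (m - j)"
  using assms
proof (induction m rule: dec_induct)
  case base
  have "(\<Prod>i\<in>{..j} - {j}. \<bar>real j - real i\<bar>) = (\<Prod>i\<in>{0..<j}. real (j - i))"
    by (rule prod.cong) auto
  also have "\<dots> = fact j"
    by (simp add: fact_prod_rev)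
  finally show ?case by simp
next
  case (step m)
  have "{..Suc m} - {j} = insert (Suc m) ({..m} - {j})"
    using step by auto
  then show ?case
    using step by (simp add: Suc_diff_le algebra_simps of_nat_diff)
qed

text \<open>\<open>m ^ m / m!\<close> is a single term of the nonnegative series of
  \<open>exp m\<close>.\<close>

lemma power_self_le_exp_fact: "real m ^ m \<le> exp (real m) * fact m"
proof -
  have "(\<Sum>n\<in>{m}. real m ^ n /\<^sub>R fact n) \<le> (\<Sum>n. real m ^ n /\<^sub>R fact n)"
    by (rule sum_le_suminf) (auto simp: summable_exp)
  then have "real m ^ m / fact m \<le> exp (real m)"
    using exp_converges[of "real m"] by (simp add: sums_iff field_simps)
  then show ?thesis
    by (simp add: field_simps)
qed

lemma power_self_le_fact: "real m ^ m \<le> 3 ^ m * fact m"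
proof -
  have "exp (real m) = exp 1 ^ m"
    by (simp flip: exp_of_nat_mult)
  also have "\<dots> \<le> 3 ^ m"
    by (intro power_mono exp_le) simp
  finally show ?thesis
    using power_self_le_exp_fact[of m] by (meson fact_ge_zero mult_right_mono order_trans)
qed

text \<open>The weights are the coefficients of degree \<open>k\<close> of the Lagrange polynomials for the nodes \<open>j / m\<close>.\<close>

lemma ex_coefficient_weights:
  assumes m: "1 \<le> m" and k: "k \<le> m"
  obtains w :: "nat \<Rightarrow> real" where
    "\<And>l. l \<le> m \<Longrightarrow> (\<Sum>j\<le>m. w j * (real j / real m) ^ l) = (if l = k then 1 else 0)"
    "(\<Sum>j\<le>m. \<bar>w j\<bar>) \<le> 12 ^ m"
proof -
  define t where "t j = real j / real m" for j
  define L where "L j = smult (\<Prod>i\<in>{..m} - {j}. 1 / (t j - t i)) (\<Prod>i\<in>{..m} - {j}. [:- t i, 1:])" for j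
  define w where "w j = coeff (L j) k" for j
  have t_eq: "t i = t j \<longleftrightarrow> i = j" for i j
    using m by (simp add: t_def)
  have L_eval: "poly (L j) (t i) = (if i = j then 1 else 0)" if "i \<le> m" "j \<le> m" for i j
  proof (cases "i = j")
    case True
    then show ?thesis
      by (auto simp: L_def poly_prod t_eq simp flip: prod.distrib intro!: prod.neutral)
  next
    case False
    then show ?thesis
      using that by (auto simp: L_def poly_prod intro!: disjI2 bexI[of _ i])
  qed
  have L_degree: "degree (L j) \<le> m" if "j \<le> m" for j
  proof -
    have "degree (\<Prod>i\<in>{..m} - {j}. [:- t i, 1:]) \<le> (\<Sum>i\<in>{..m} - {j}. 1)"
      by (rule order_trans[OF degree_prod_sum_le]) auto
    then show ?thesis
      using that unfolding L_def by (intro order_trans[OF degree_smult_le]) simp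
  qed
  \<comment> \<open>Both sides have degree at most \<open>m\<close> and agree at the
    \<open>m + 1\<close> nodes. Comparing the coefficients of degree \<open>k\<close> then gives the
    defining property of the weights.\<close>
  have interpolate: "(\<Sum>j\<le>m. smult (t j ^ l) (L j)) = monom 1 l" if "l \<le> m" for l
  proof (rule ccontr)
    let ?D = "(\<Sum>j\<le>m. smult (t j ^ l) (L j)) - monom 1 l"
    assume "\<not> ?thesis"
    then have nz: "?D \<noteq> 0" by simp
    have "poly ?D (t i) = 0" if "i \<le> m" for i
      using that by (simp add: poly_sum poly_monom L_eval if_distrib cong: if_cong)
    then have "t ` {..m} \<subseteq> {x. poly ?D x = 0}" by auto
    then have "card (t ` {..m}) \<le> card {x. poly ?D x = 0}"
      by (intro card_mono poly_roots_finite nz)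
    also have "\<dots> \<le> degree ?D"
      by (rule card_poly_roots_bound[OF nz])
    also have "\<dots> \<le> m"
      using L_degree that
      by (intro degree_diff_le degree_sum_le) (auto intro: order_trans[OF degree_smult_le] simp: degree_monom_eq)
    finally show False
      by (simp add: card_image inj_on_def t_eq)
  qed
  have weights: "(\<Sum>j\<le>m. w j * (real j / real m) ^ l) = (if l = k then 1 else 0)" if "l \<le> m" for l
    using arg_cong[OF interpolate[OF that], of "\<lambda>p. coeff p k"]
    by (simp add: coeff_sum w_def t_def mult.commute split: if_splits)
  \<comment> \<open>\<open>6 = 3 * 2\<close>: the factor \<open>3 ^ m\<close> comes from
    \<open>m ^ m\<close> against \<open>m!\<close> after clearing the node denominators,
    \<open>2 ^ m\<close> from the numerator. Summing the binomial coefficients gives another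
    \<open>2 ^ m\<close>, hence \<open>12\<close>.\<close>
  have w_le: "\<bar>w j\<bar> \<le> 6 ^ m * real (m choose j)" if j: "j \<le> m" for j
  proof -
    have card: "card ({..m} - {j}) = m"
      using j by simp
    have diff: "\<bar>1 / (t j - t i)\<bar> = real m / \<bar>real j - real i\<bar>" for i
      using m by (simp add: t_def flip: diff_divide_distrib)
    have "\<bar>\<Prod>i\<in>{..m} - {j}. 1 / (t j - t i)\<bar> = (\<Prod>i\<in>{..m} - {j}. real m / \<bar>real j - real i\<bar>)"
      unfolding abs_prod diff ..
    also have "\<dots> = real m ^ m / (fact j * fact (m - j))"
      using card by (simp add: prod_dividef prod_abs_diff_eq_fact[OF j])
    also have "\<dots> \<le> 3 ^ m * fact m / (fact j * fact (m - j))"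
      by (intro divide_right_mono power_self_le_fact) simp
    also have "\<dots> = 3 ^ m * real (m choose j)"
      using binomial_fact[OF j, where ?'a = real] by simp
    finally have A: "\<bar>\<Prod>i\<in>{..m} - {j}. 1 / (t j - t i)\<bar> \<le> 3 ^ m * real (m choose j)" .
    have "\<bar>coeff (\<Prod>i\<in>{..m} - {j}. [:- t i, 1:]) k\<bar> \<le> 2 ^ m"
      using abs_coeff_prod_linear_le[of "{..m} - {j}" t k] m unfolding card by (auto simp: t_def)
    then have "\<bar>w j\<bar> \<le> (3 ^ m * real (m choose j)) * 2 ^ m"
      unfolding w_def L_def coeff_smult abs_mult using A by (intro mult_mono) auto
    also have "\<dots> = 6 ^ m * real (m choose j)"
      by (simp flip: power_mult_distrib)
    finally show ?thesis .
  qed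
  have "(\<Sum>j\<le>m. \<bar>w j\<bar>) \<le> (\<Sum>j\<le>m. 6 ^ m * real (m choose j))"
    by (intro sum_mono w_le) simp
  also have "\<dots> = 6 ^ m * 2 ^ m"
    by (simp flip: sum_distrib_left of_nat_sum add: choose_row_sum)
  also have "\<dots> = 12 ^ m"
    by (simp flip: power_mult_distrib)
  finally show thesis
    using weights that by blast
qed

section \<open>Decoupling\<close>

text \<open>When \<open>c\<close> is a bijection from \<open>A\<close> onto the colours, the two
  products coincide and the signs square away. Otherwise, as \<open>A\<close> has exactly
  \<open>k\<close> elements, some colour \<open>l\<close> is missed; flipping
  \<open>\<delta> l\<close> reverses the first product and leaves the second alone, so the average
  is its own negative.\<close>

lemma sign_avg_transversal:
  assumes A: "finite A" "card A = k"
  shows "sign_avg k (\<lambda>\<delta>. (\<Prod>l<k. \<delta> l) * (\<Prod>i\<in>A. \<delta> (c i))) = (if bij_betw c A {..<k} then 1 else 0)"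
proof (cases "bij_betw c A {..<k}")
  case True
  have "sign_avg k (\<lambda>\<delta>. (\<Prod>l<k. \<delta> l) * (\<Prod>i\<in>A. \<delta> (c i))) = sign_avg k (\<lambda>\<delta>. \<Prod>l<k. \<delta> l * \<delta> l)"
    by (simp add: prod.reindex_bij_betw[OF True, where g = "\<lambda>l. _ l"] prod.distrib)
  also have "\<dots> = sign_avg k (\<lambda>_. 1)"
    by (intro sign_avg_cong) simp
  finally show ?thesis
    using True by simp
next
  case False
  have "\<exists>l<k. l \<notin> c ` A"
  proof (rule ccontr)
    assume "\<not> ?thesis"
    then have sub: "{..<k} \<subseteq> c ` A" by auto
    have "card (c ` A) \<le> k"
      using card_image_le A by blast
    then have "c ` A = {..<k}"
      using sub A(1) by (metis card_lessThan card_seteq finite_imageI)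
    moreover from this have "inj_on c A"
      using A by (intro eq_card_imp_inj_on) auto
    ultimately show False
      using False by (simp add: bij_betw_def)
  qed
  then obtain l where l: "l < k" "l \<notin> c ` A" by blast
  define \<eta> where "\<eta> i = (if i = l then -1 else 1 :: real)" for i
  let ?g = "\<lambda>\<delta>. (\<Prod>l<k. \<delta> l) * (\<Prod>i\<in>A. \<delta> (c i)) :: real"
  have \<eta>: "\<eta> \<in> signs k"
    using l by (auto simp: signs_iff \<eta>_def)
  have "(\<Prod>i<k. \<eta> i) = -1"
    using l by (simp add: \<eta>_def prod.delta)
  moreover have "(\<Prod>i\<in>A. \<eta> (c i)) = 1"
    using l by (intro prod.neutral) (auto simp: \<eta>_def)
  ultimately have "?g (\<lambda>i. \<eta> i * \<delta> i) = - 1 * ?g \<delta>" for \<delta>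
    by (simp add: prod.distrib)
  then have "sign_avg k ?g = - 1 * sign_avg k ?g"
    using sign_avg_mult_sign[OF \<eta>, of ?g] by (simp only: sign_avg_cmult)
  then show ?thesis
    using False by simp
qed

text \<open>One multiplier performs two filters at once: dilations by \<open>j / m\<close> select
  the cardinality \<open>k\<close>, and the colour signs \<open>\<delta>\<close> select the sets
  meeting each colour once. The colour weights have total mass one, so the mass stays that of the
  dilation weights.\<close>

lemma sign_avg_decouple:
  fixes x :: "nat set \<Rightarrow> 'a::real_normed_vector" and q :: real and c :: "nat \<Rightarrow> nat"
  assumes q: "1 \<le> q" and F: "\<And>A. A \<in> F \<Longrightarrow> A \<subseteq> {..<N} \<and> card A \<le> m"
    and m: "1 \<le> m" and k: "k \<le> m"
  shows "sign_avg N (\<lambda>\<epsilon>. norm (\<Sum>A\<in>F. (\<Prod>i\<in>A. \<epsilon> i) *\<^sub>R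
        (if card A = k \<and> bij_betw c A {..<k} then x A else 0)) powr q)
    \<le> (12 powr q) ^ m * sign_avg N (\<lambda>\<epsilon>. norm (\<Sum>A\<in>F. (\<Prod>i\<in>A. \<epsilon> i) *\<^sub>R x A) powr q)"
proof -
  obtain w :: "nat \<Rightarrow> real" where
    w: "\<And>l. l \<le> m \<Longrightarrow> (\<Sum>j\<le>m. w j * (real j / real m) ^ l) = (if l = k then 1 else 0)" and
    w_sum: "(\<Sum>j\<le>m. \<bar>w j\<bar>) \<le> 12 ^ m"
    using ex_coefficient_weights[OF m k] by metis
  define J where "J = {..m} \<times> signs k"
  define W where "W = (\<lambda>(j, \<delta>). w j * ((\<Prod>l<k. \<delta> l) / 2 ^ k))"
  define \<rho> where "\<rho> = (\<lambda>(j, \<delta>) i. (real j / real m) * \<delta> (c i))"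
  let ?E = "sign_avg N (\<lambda>\<epsilon>. norm (\<Sum>A\<in>F. (\<Prod>i\<in>A. \<epsilon> i) *\<^sub>R x A) powr q)"
  have finA: "finite A" if "A \<in> F" for A
    using F[OF that] finite_subset by blast
  have coeff: "(\<Sum>j\<in>J. W j * (\<Prod>i\<in>A. \<rho> j i)) = (if card A = k \<and> bij_betw c A {..<k} then 1 else 0)"
    if A: "A \<in> F" for A
  proof -
    have "(\<Sum>j\<in>J. W j * (\<Prod>i\<in>A. \<rho> j i))
        = (\<Sum>j\<le>m. \<Sum>\<delta>\<in>signs k. (w j * (real j / real m) ^ card A) *
            (((\<Prod>l<k. \<delta> l) * (\<Prod>i\<in>A. \<delta> (c i))) / 2 ^ k))"
      unfolding J_def W_def \<rho>_def sum.cartesian_product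
      by (intro sum.cong refl) (auto simp: prod.distrib prod_dividef power_divide mult_ac)
    also have "\<dots> = (\<Sum>j\<le>m. w j * (real j / real m) ^ card A) *
        sign_avg k (\<lambda>\<delta>. (\<Prod>l<k. \<delta> l) * (\<Prod>i\<in>A. \<delta> (c i)))"
      by (simp only: sign_avg_def sum_divide_distrib sum_product)
    \<comment> \<open>The dilation factor vanishes unless \<open>card A = k\<close>, which is the
      case that \<open>sign_avg_transversal\<close> requires.\<close>
    finally show ?thesis
      using w[of "card A"] F[OF A] sign_avg_transversal[OF finA[OF A], of k c] by auto
  qed
  have "(\<Sum>j\<in>J. \<bar>W j\<bar>) = (\<Sum>j\<le>m. \<Sum>\<delta>\<in>signs k. \<bar>w j\<bar> / 2 ^ k)"
    unfolding J_def W_def sum.cartesian_product by (intro sum.cong refl) (auto simp: abs_mult abs_prod)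
  also have "\<dots> = (\<Sum>j\<le>m. \<bar>w j\<bar>)" by simp
  finally have W_sum: "(\<Sum>j\<in>J. \<bar>W j\<bar>) \<le> 12 ^ m"
    using w_sum by simp
  have E0: "0 \<le> ?E"
    by (intro sign_avg_nonneg) simp
  have "sign_avg N (\<lambda>\<epsilon>. norm (\<Sum>A\<in>F. (\<Prod>i\<in>A. \<epsilon> i) *\<^sub>R
        (if card A = k \<and> bij_betw c A {..<k} then x A else 0)) powr q)
      = sign_avg N (\<lambda>\<epsilon>. norm (\<Sum>A\<in>F. ((\<Sum>j\<in>J. W j * (\<Prod>i\<in>A. \<rho> j i)) * (\<Prod>i\<in>A. \<epsilon> i)) *\<^sub>R x A) powr q)"
    by (intro sign_avg_cong arg_cong[where f = "\<lambda>v. norm v powr q"] sum.cong refl) (simp add: coeff)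
  also have "\<dots> \<le> (\<Sum>j\<in>J. \<bar>W j\<bar>) powr q * ?E"
  proof (intro sign_avg_multiplier_le q)
    show "finite J" by (simp add: J_def)
    fix j assume "j \<in> J"
    then have "\<bar>\<rho> j i\<bar> \<le> 1" for i
      using m by (auto simp: J_def \<rho>_def abs_mult)
    then show "sign_avg N (\<lambda>\<epsilon>. norm (\<Sum>A\<in>F. (\<Prod>i\<in>A. \<rho> j i * \<epsilon> i) *\<^sub>R x A) powr q) \<le> ?E"
      using F by (intro sign_avg_contraction q) auto
  qed
  also have "\<dots> \<le> (12 ^ m) powr q * ?E"
    using W_sum q E0 by (intro mult_right_mono powr_mono2) (auto intro: sum_nonneg)
  also have "(12 ^ m) powr q = (12 powr q) ^ m"
    by (simp add: powr_powr mult.commute flip: powr_realpow)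
  finally show ?thesis .
qed

section \<open>Iterating Rademacher cotype\<close>

definition transversals :: "(nat \<Rightarrow> nat) \<Rightarrow> nat \<Rightarrow> nat \<Rightarrow> nat set set" where
  "transversals c N k = {A. A \<subseteq> {..<N} \<and> bij_betw c A {..<k}}"

text \<open>A transversal for \<open>Suc k\<close> is its element of colour \<open>k\<close>
  together with a transversal for \<open>k\<close>. The colours tell the two parts apart, which
  makes the decomposition unique.\<close>

lemma sum_transversals_Suc:
  fixes g :: "nat set \<Rightarrow> 'b::comm_monoid_add"
  shows "(\<Sum>A\<in>transversals c N (Suc k). g A) = (\<Sum>i\<in>{i. i < N \<and> c i = k}. \<Sum>B\<in>transversals c N k. g (insert i B))"
proof -
  let ?S = "{i. i < N \<and> c i = k}"
  have notin: "i \<notin> B" if "c i = k" "B \<in> transversals c N k" for i B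
    using that by (auto simp: transversals_def bij_betw_def)
  have inj: "inj_on (\<lambda>(i, B). insert i B) (?S \<times> transversals c N k)"
  proof (rule inj_onI)
    fix p p' assume p: "p \<in> ?S \<times> transversals c N k" "p' \<in> ?S \<times> transversals c N k"
      and eq: "(\<lambda>(i, B). insert i B) p = (\<lambda>(i, B). insert i B) p'"
    obtain i B i' B' where [simp]: "p = (i, B)" "p' = (i', B')" by fastforce
    have "i \<notin> B'" "i' \<notin> B" "i \<notin> B" "i' \<notin> B'"
      using p notin by auto
    then show "p = p'"
      using eq by (auto simp: set_eq_iff)
  qed
  have "transversals c N (Suc k) = (\<lambda>(i, B). insert i B) ` (?S \<times> transversals c N k)"
  proof (intro equalityI subsetI)
    fix A assume A: "A \<in> transversals c N (Suc k)"
    then have bij: "bij_betw c A {..<Suc k}" and sub: "A \<subseteq> {..<N}" by (auto simp: transversals_def)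
    then have "k \<in> c ` A" by (auto simp: bij_betw_def)
    then obtain i where i: "i \<in> A" "c i = k" by blast
    have "bij_betw c (A - {i}) ({..<Suc k} - {c i})"
      using bij i by (intro bij_betw_DiffI) (auto simp: bij_betw_def)
    then have "bij_betw c (A - {i}) {..<k}"
      using i by (simp add: lessThan_Suc)
    then have "A - {i} \<in> transversals c N k"
      using sub by (auto simp: transversals_def)
    moreover have "A = insert i (A - {i})" "i \<in> ?S"
      using i sub by auto
    ultimately show "A \<in> (\<lambda>(i, B). insert i B) ` (?S \<times> transversals c N k)"
      by (intro image_eqI[of _ _ "(i, A - {i})"]) auto
  next
    fix A assume "A \<in> (\<lambda>(i, B). insert i B) ` (?S \<times> transversals c N k)"
    then obtain i B where A: "A = insert i B" "i < N" "c i = k" "B \<in> transversals c N k" by auto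
    then have "bij_betw c (insert i B) (insert k {..<k})"
      using notin[of i B] notIn_Un_bij_betw[of i B c "{..<k}"] by (auto simp: transversals_def)
    then show "A \<in> transversals c N (Suc k)"
      using A by (auto simp: transversals_def lessThan_Suc)
  qed
  then have "(\<Sum>A\<in>transversals c N (Suc k). g A) = (\<Sum>(i, B)\<in>?S \<times> transversals c N k. g (insert i B))"
    using inj by (simp add: sum.reindex o_def case_prod_unfold)
  then show ?thesis
    by (simp add: sum.cartesian_product)
qed

text \<open>Induction on the number of colours. With the signs of smaller colours held fixed the
  polynomial is linear in the signs of colour \<open>k\<close>, so cotype applies to the vectors
  \<open>V i \<epsilon>\<close> and costs one factor \<open>R\<close>; the induction hypothesis
  treats each \<open>V i\<close>.\<close>

lemma sum_transversals_le:
  fixes y :: "nat set \<Rightarrow> 'a::real_normed_vector" and q R :: real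
  assumes R: "0 \<le> R"
    and cotype: "\<And>x :: nat \<Rightarrow> 'a. (\<Sum>i<N. norm (x i) powr q)
      \<le> R * sign_avg N (\<lambda>\<epsilon>. norm (\<Sum>i<N. \<epsilon> i *\<^sub>R x i) powr q)"
  shows "(\<Sum>A\<in>transversals c N k. norm (y A) powr q)
    \<le> R ^ k * sign_avg N (\<lambda>\<epsilon>. norm (\<Sum>A\<in>transversals c N k. (\<Prod>i\<in>A. \<epsilon> i) *\<^sub>R y A) powr q)"
proof (induction k arbitrary: y)
  case 0
  have "transversals c N 0 = {{}}"
    by (auto simp: transversals_def bij_betw_def)
  then show ?case by simp
next
  case (Suc k)
  let ?S = "{i. i < N \<and> c i = k}"
  define V where "V i \<epsilon> = (\<Sum>B\<in>transversals c N k. (\<Prod>j\<in>B. \<epsilon> j) *\<^sub>R y (insert i B))" for i and \<epsilon> :: "nat \<Rightarrow> real"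
  define G where "G \<epsilon> = norm (\<Sum>A\<in>transversals c N (Suc k). (\<Prod>i\<in>A. \<epsilon> i) *\<^sub>R y A) powr q" for \<epsilon>
  have notin: "i \<notin> B" if "c i = k" "B \<in> transversals c N k" for i B
    using that by (auto simp: transversals_def bij_betw_def)
  have fin: "finite B" if "B \<in> transversals c N k" for B
    using that by (auto simp: transversals_def intro: finite_subset)
  have G: "G \<epsilon> = norm (\<Sum>i\<in>?S. \<epsilon> i *\<^sub>R V i \<epsilon>) powr q" for \<epsilon>
    unfolding G_def V_def sum_transversals_Suc
    by (simp add: scaleR_sum_right) (intro arg_cong[where f = "\<lambda>v. norm v powr q"] sum.cong refl,
        auto simp: notin fin)
  \<comment> \<open>Multiplying only the signs of colour \<open>k\<close> by an auxiliary
    \<open>\<eta>\<close> randomises that group, while each \<open>V i\<close>, built from smaller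
    colours, is unchanged.\<close>
  define flip where "flip \<eta> i = (if c i = k then \<eta> i else 1 :: real)" for \<eta> i
  have flip: "flip \<eta> \<in> signs N" if "\<eta> \<in> signs N" for \<eta>
    using that by (auto simp: signs_iff flip_def)
  have V_flip: "V i (\<lambda>j. flip \<eta> j * \<epsilon> j) = V i \<epsilon>" for i \<eta> \<epsilon>
    unfolding V_def by (intro sum.cong refl arg_cong2[where f = "(*\<^sub>R)"] prod.cong)
      (use notin in \<open>auto simp: flip_def\<close>)
  have step: "(\<Sum>i\<in>?S. norm (V i \<epsilon>) powr q) \<le> R * sign_avg N (\<lambda>\<eta>. G (\<lambda>j. flip \<eta> j * \<epsilon> j))"
    if \<epsilon>: "\<epsilon> \<in> signs N" for \<epsilon>
  proof -
    \<comment> \<open>Extension by zero outside the colour class, since \<open>cotype\<close> is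
      assumed for sums over all of \<open>{..<N}\<close>; the factor \<open>\<epsilon> i\<close>
      does not alter norms.\<close>
    define x where "x i = (if c i = k then \<epsilon> i *\<^sub>R V i \<epsilon> else 0)" for i
    have S: "(\<Sum>i<N. if c i = k then h i else 0) = (\<Sum>i\<in>?S. h i)" for h :: "nat \<Rightarrow> 'b::comm_monoid_add"
      by (subst sum.inter_filter[symmetric]) (auto intro!: sum.cong)
    have "(\<Sum>i\<in>?S. norm (V i \<epsilon>) powr q) = (\<Sum>i<N. norm (x i) powr q)"
      unfolding S[symmetric] using \<epsilon> by (intro sum.cong refl) (simp add: x_def)
    also have "\<dots> \<le> R * sign_avg N (\<lambda>\<eta>. norm (\<Sum>i<N. \<eta> i *\<^sub>R x i) powr q)"
      by (rule cotype)
    also have "(\<lambda>\<eta>. norm (\<Sum>i<N. \<eta> i *\<^sub>R x i) powr q) = (\<lambda>\<eta>. G (\<lambda>j. flip \<eta> j * \<epsilon> j))"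
    proof
      fix \<eta> :: "nat \<Rightarrow> real"
      have "(\<Sum>i<N. \<eta> i *\<^sub>R x i) = (\<Sum>i\<in>?S. (flip \<eta> i * \<epsilon> i) *\<^sub>R V i \<epsilon>)"
        unfolding S[symmetric] by (intro sum.cong refl) (simp add: x_def flip_def)
      then show "norm (\<Sum>i<N. \<eta> i *\<^sub>R x i) powr q = G (\<lambda>j. flip \<eta> j * \<epsilon> j)"
        by (simp add: G V_flip)
    qed
    finally show ?thesis .
  qed
  have "(\<Sum>A\<in>transversals c N (Suc k). norm (y A) powr q) = (\<Sum>i\<in>?S. \<Sum>B\<in>transversals c N k. norm (y (insert i B)) powr q)"
    by (rule sum_transversals_Suc)
  also have "\<dots> \<le> (\<Sum>i\<in>?S. R ^ k * sign_avg N (\<lambda>\<epsilon>. norm (V i \<epsilon>) powr q))"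
    unfolding V_def by (intro sum_mono Suc.IH)
  also have "\<dots> = R ^ k * sign_avg N (\<lambda>\<epsilon>. \<Sum>i\<in>?S. norm (V i \<epsilon>) powr q)"
    by (simp add: sum_distrib_left sign_avg_sum)
  also have "\<dots> \<le> R ^ k * sign_avg N (\<lambda>\<epsilon>. R * sign_avg N (\<lambda>\<eta>. G (\<lambda>j. flip \<eta> j * \<epsilon> j)))"
    using R by (intro mult_left_mono sign_avg_mono step) auto
  also have "\<dots> = R ^ k * (R * sign_avg N (\<lambda>\<eta>. sign_avg N (\<lambda>\<epsilon>. G (\<lambda>j. flip \<eta> j * \<epsilon> j))))"
    unfolding sign_avg_cmult by (subst sign_avg_swap) (rule refl)
  \<comment> \<open>For each fixed \<open>\<eta>\<close> the sign change is a symmetry of the cube,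
    so the auxiliary average disappears.\<close>
  also have "sign_avg N (\<lambda>\<eta>. sign_avg N (\<lambda>\<epsilon>. G (\<lambda>j. flip \<eta> j * \<epsilon> j))) = sign_avg N (\<lambda>\<eta>. sign_avg N G)"
    by (intro sign_avg_cong sign_avg_mult_sign flip)
  finally show ?case
    unfolding G_def[abs_def] sign_avg_const power_Suc by (simp only: mult.assoc mult.left_commute)
qed

text \<open>For positive \<open>k\<close>, exactly \<open>k! * k ^ (N - k)\<close> of the
  \<open>k ^ N\<close> colourings are injective on \<open>A\<close>, hence bijective onto the
  colours. The colour set has \<open>max k 1\<close> elements so that it stays nonempty for
  \<open>k = 0\<close>, where \<open>A\<close> is empty.\<close>

lemma card_transversal_colourings_ge:
  assumes A: "A \<subseteq> {..<N}" "card A = k" and k: "k \<le> m"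
  shows "real (max k 1 ^ N) \<le> 3 ^ m * real (card {c \<in> {..<N} \<rightarrow>\<^sub>E {..<max k 1}. bij_betw c A {..<k}})"
proof (cases "k = 0")
  case True
  then have "A = {}"
    using A by (simp add: finite_subset)
  then show ?thesis
    using True by (simp add: card_funcsetE bij_betw_def)
next
  case False
  have kN: "k \<le> N"
    using card_mono[OF finite_lessThan A(1)] A(2) by simp
  have "{c \<in> {..<N} \<rightarrow>\<^sub>E {..<k}. bij_betw c A {..<k}} = {c \<in> {..<N} \<rightarrow>\<^sub>E {..<k}. inj_on c A}"
  proof (intro Collect_cong conj_cong refl)
    fix c assume "c \<in> {..<N} \<rightarrow>\<^sub>E {..<k}"
    then have "c ` A \<subseteq> {..<k}"
      using A by auto
    then show "bij_betw c A {..<k} \<longleftrightarrow> inj_on c A"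
      using A(2) card_subset_eq[of "{..<k}" "c ` A"] by (auto simp: bij_betw_def card_image)
  qed
  then have "real (card {c \<in> {..<N} \<rightarrow>\<^sub>E {..<k}. bij_betw c A {..<k}}) = real k ^ (N - k) * fact k"
    using card_inj_on_subset_funcset[of "{..<N}" "{..<k}" A] A
    by (simp add: fact_prod_rev)
  moreover have "real k ^ N \<le> 3 ^ m * (real k ^ (N - k) * fact k)"
  proof -
    have "real k ^ N = real k ^ (N - k) * real k ^ k"
      using kN by (simp flip: power_add)
    also have "\<dots> \<le> real k ^ (N - k) * (3 ^ k * fact k)"
      by (intro mult_left_mono power_self_le_fact) simp
    also have "\<dots> \<le> real k ^ (N - k) * (3 ^ m * fact k)"
      using k by (intro mult_left_mono mult_right_mono power_increasing) auto
    finally show ?thesis by (simp add: mult_ac)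
  qed
  ultimately show ?thesis
    using False by (simp add: max_absorb1)
qed

text \<open>Double counting of pairs of a set in \<open>H\<close> and a colouring in
  \<open>C\<close>. The bound for a single colouring does not depend on the colouring, so after
  exchanging the sums the number of colourings cancels.\<close>

lemma sum_homogeneous_le:
  fixes x :: "nat set \<Rightarrow> 'a::real_normed_vector" and q R :: real
  assumes q: "1 \<le> q" and R: "1 \<le> R"
    and cotype: "\<And>x :: nat \<Rightarrow> 'a. (\<Sum>i<N. norm (x i) powr q)
      \<le> R * sign_avg N (\<lambda>\<epsilon>. norm (\<Sum>i<N. \<epsilon> i *\<^sub>R x i) powr q)"
    and F: "\<And>A. A \<in> F \<Longrightarrow> A \<subseteq> {..<N} \<and> card A \<le> m" and m: "1 \<le> m" and k: "k \<le> m"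
  shows "(\<Sum>A\<in>{A\<in>F. card A = k}. norm (x A) powr q)
    \<le> (3 * R * 12 powr q) ^ m * sign_avg N (\<lambda>\<epsilon>. norm (\<Sum>A\<in>F. (\<Prod>i\<in>A. \<epsilon> i) *\<^sub>R x A) powr q)"
proof -
  define E where "E = sign_avg N (\<lambda>\<epsilon>. norm (\<Sum>A\<in>F. (\<Prod>i\<in>A. \<epsilon> i) *\<^sub>R x A) powr q)"
  define C where "C = ({..<N} \<rightarrow>\<^sub>E {..<max k 1})"
  define H where "H = {A\<in>F. card A = k}"
  have finF: "finite F"
    using F by (intro finite_subset[of F "Pow {..<N}"]) auto
  have finC: "finite C" and cardC: "card C = max k 1 ^ N"
    by (auto simp: C_def card_funcsetE intro!: finite_PiE)
  have E0: "0 \<le> E"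
    unfolding E_def by (intro sign_avg_nonneg) simp
  have colouring: "(\<Sum>A\<in>H. if bij_betw c A {..<k} then norm (x A) powr q else 0) \<le> R ^ m * ((12 powr q) ^ m * E)" for c
  proof -
    define Tr where "Tr = transversals c N k"
    \<comment> \<open>\<open>F\<close> need not contain every transversal; the missing coefficients
      are set to zero.\<close>
    define y where "y A = (if A \<in> F then x A else 0)" for A
    have finTr: "finite Tr"
      by (rule finite_subset[of _ "Pow {..<N}"]) (auto simp: Tr_def transversals_def)
    have card_Tr: "card A = k" if "bij_betw c A {..<k}" for A
      using bij_betw_same_card[OF that] by simp
    have sum_eq: "(\<Sum>A\<in>Tr. if A \<in> F then h A else 0) = (\<Sum>A\<in>F. if card A = k \<and> bij_betw c A {..<k} then h A else 0)"
      for h :: "nat set \<Rightarrow> 'b::comm_monoid_add"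
    proof -
      have "(\<Sum>A\<in>Tr. if A \<in> F then h A else 0) = sum h (Tr \<inter> F)"
        by (rule sum.inter_restrict[OF finTr, symmetric])
      also have "\<dots> = sum h (F \<inter> {A. card A = k \<and> bij_betw c A {..<k}})"
        using F card_Tr by (intro sum.cong) (auto simp: Tr_def transversals_def)
      also have "\<dots> = (\<Sum>A\<in>F. if card A = k \<and> bij_betw c A {..<k} then h A else 0)"
        using sum.inter_restrict[OF finF, of h "{A. card A = k \<and> bij_betw c A {..<k}}"] by simp
      finally show ?thesis .
    qed
    have "(\<Sum>A\<in>H. if bij_betw c A {..<k} then norm (x A) powr q else 0)
        = (\<Sum>A\<in>F. if card A = k \<and> bij_betw c A {..<k} then norm (x A) powr q else 0)"
      unfolding H_def using finF by (simp add: sum.inter_filter) (intro sum.cong, auto)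
    also have "\<dots> = (\<Sum>A\<in>Tr. norm (y A) powr q)"
      unfolding sum_eq[symmetric] y_def using q by (intro sum.cong) auto
    also have "\<dots> \<le> R ^ k * sign_avg N (\<lambda>\<epsilon>. norm (\<Sum>A\<in>Tr. (\<Prod>i\<in>A. \<epsilon> i) *\<^sub>R y A) powr q)"
      unfolding Tr_def using R by (intro sum_transversals_le cotype) auto
    also have "(\<lambda>\<epsilon>. norm (\<Sum>A\<in>Tr. (\<Prod>i\<in>A. \<epsilon> i) *\<^sub>R y A) powr q)
        = (\<lambda>\<epsilon>. norm (\<Sum>A\<in>F. (\<Prod>i\<in>A. \<epsilon> i) *\<^sub>R
            (if card A = k \<and> bij_betw c A {..<k} then x A else 0)) powr q)"
      by (simp add: y_def if_distrib[of "scaleR _"] sum_eq cong: if_cong)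
    also have "R ^ k * sign_avg N \<dots> \<le> R ^ m * ((12 powr q) ^ m * E)"
      unfolding E_def using R k
      by (intro mult_mono power_increasing sign_avg_decouple q F m sign_avg_nonneg) auto
    finally show ?thesis .
  qed
  have "real (card C) * (\<Sum>A\<in>H. norm (x A) powr q)
      \<le> 3 ^ m * (\<Sum>A\<in>H. real (card {c\<in>C. bij_betw c A {..<k}}) * norm (x A) powr q)"
    unfolding sum_distrib_left
  proof (rule sum_mono)
    fix A assume "A \<in> H"
    then have "real (card C) \<le> 3 ^ m * real (card {c\<in>C. bij_betw c A {..<k}})"
      using card_transversal_colourings_ge[of A N k m] F k unfolding cardC by (auto simp: H_def C_def)
    then show "real (card C) * norm (x A) powr q
        \<le> 3 ^ m * (real (card {c\<in>C. bij_betw c A {..<k}}) * norm (x A) powr q)"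
      unfolding mult.assoc[symmetric] by (intro mult_right_mono) auto
  qed
  also have "(\<Sum>A\<in>H. real (card {c\<in>C. bij_betw c A {..<k}}) * norm (x A) powr q)
      = (\<Sum>A\<in>H. \<Sum>c\<in>C. if bij_betw c A {..<k} then norm (x A) powr q else 0)"
    using finC by (simp flip: sum.inter_filter)
  also have "\<dots> = (\<Sum>c\<in>C. \<Sum>A\<in>H. if bij_betw c A {..<k} then norm (x A) powr q else 0)"
    by (rule sum.swap)
  also have "\<dots> \<le> (\<Sum>c\<in>C. R ^ m * ((12 powr q) ^ m * E))"
    by (intro sum_mono colouring)
  finally have "real (card C) * (\<Sum>A\<in>H. norm (x A) powr q)
      \<le> real (card C) * ((3 * R * 12 powr q) ^ m * E)"
    by (simp add: power_mult_distrib mult_ac)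
  moreover have "0 < real (card C)"
    by (auto simp: cardC max_def)
  ultimately have "(\<Sum>A\<in>H. norm (x A) powr q) \<le> (3 * R * 12 powr q) ^ m * E"
    by (simp only: mult_le_cancel_left_pos)
  then show ?thesis
    by (simp add: H_def E_def)
qed

text \<open>The degrees \<open>0\<close> to \<open>m\<close> are bounded separately by the same
  quantity; their number \<open>m + 1\<close> is at most \<open>2 ^ m\<close>, which turns
  \<open>3\<close> into \<open>6\<close>.\<close>

lemma sum_walsh_le:
  fixes x :: "nat set \<Rightarrow> 'a::real_normed_vector" and q R :: real
  assumes q: "1 \<le> q" and R: "1 \<le> R"
    and cotype: "\<And>x :: nat \<Rightarrow> 'a. (\<Sum>i<N. norm (x i) powr q)
      \<le> R * sign_avg N (\<lambda>\<epsilon>. norm (\<Sum>i<N. \<epsilon> i *\<^sub>R x i) powr q)"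
    and F: "\<And>A. A \<in> F \<Longrightarrow> A \<subseteq> {..<N} \<and> card A \<le> m" and m: "1 \<le> m"
  shows "(\<Sum>A\<in>F. norm (x A) powr q)
    \<le> (6 * R * 12 powr q) ^ m * sign_avg N (\<lambda>\<epsilon>. norm (\<Sum>A\<in>F. (\<Prod>i\<in>A. \<epsilon> i) *\<^sub>R x A) powr q)"
proof -
  define E where "E = sign_avg N (\<lambda>\<epsilon>. norm (\<Sum>A\<in>F. (\<Prod>i\<in>A. \<epsilon> i) *\<^sub>R x A) powr q)"
  have E0: "0 \<le> E"
    unfolding E_def by (intro sign_avg_nonneg) simp
  have finF: "finite F"
    using F by (intro finite_subset[of F "Pow {..<N}"]) auto
  have "(\<Sum>A\<in>F. norm (x A) powr q) = (\<Sum>k\<le>m. \<Sum>A\<in>{A\<in>F. card A = k}. norm (x A) powr q)"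
    using F finF by (intro sum.group[symmetric]) auto
  also have "\<dots> \<le> (\<Sum>k\<le>m. (3 * R * 12 powr q) ^ m * E)"
    unfolding E_def by (intro sum_mono sum_homogeneous_le q R cotype F m) auto
  also have "\<dots> = real (m + 1) * ((3 * R * 12 powr q) ^ m * E)"
    by simp
  also have "\<dots> \<le> 2 ^ m * ((3 * R * 12 powr q) ^ m * E)"
  proof (intro mult_right_mono)
    have "m + 1 \<le> 2 ^ m"
      using less_exp[of m] by (simp add: Suc_le_eq)
    then show "real (m + 1) \<le> 2 ^ m"
      by (metis of_nat_le_iff of_nat_numeral of_nat_power)
  qed (use R E0 in auto)
  also have "\<dots> = (6 * R * 12 powr q) ^ m * E"
    by (simp flip: mult.assoc power_mult_distrib)
  finally show ?thesis
    by (simp add: E_def)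
qed

section \<open>Integration over the sign measure and the torus\<close>

text \<open>Both measures live on a finite set with all subsets measurable, so comparing singletons
  suffices.\<close>

lemma PiM_uniform_count_measure:
  assumes I: "finite I" and A: "finite A" "A \<noteq> {}"
  shows "PiM I (\<lambda>_. uniform_count_measure A) = uniform_count_measure (PiE I (\<lambda>_. A))"
proof -
  interpret U: prob_space "uniform_count_measure A"
    by (rule prob_space_uniform_count_measure[OF A])
  interpret product_prob_space "\<lambda>_. uniform_count_measure A" I ..
  have finite: "finite (PiE I (\<lambda>_. A))"
    by (intro finite_PiE I A)
  have sets: "sets (PiM I (\<lambda>_. uniform_count_measure A)) = Pow (PiE I (\<lambda>_. A))"
  proof -
    have "sets (PiM I (\<lambda>_. uniform_count_measure A)) = sets (PiM I (\<lambda>_. count_space A))"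
      by (intro sets_PiM_cong refl sets_uniform_count_measure_count_space)
    then show ?thesis
      using I by (subst (asm) count_space_PiM_finite) (auto intro: countable_finite A)
  qed
  show ?thesis
  proof (rule measure_eqI_finite[OF sets _ finite])
    fix f assume f: "f \<in> PiE I (\<lambda>_. A)"
    then have single: "{f} = PiE I (\<lambda>i. {f i})"
      by (intro PiE_singleton[symmetric]) (simp add: PiE_iff)
    have "emeasure (PiM I (\<lambda>_. uniform_count_measure A)) {f} = (\<Prod>i\<in>I. emeasure (uniform_count_measure A) {f i})"
      using f unfolding single by (intro emeasure_PiM I) (auto simp: sets_uniform_count_measure_count_space)
    also have "\<dots> = (\<Prod>i\<in>I. ennreal (1 / real (card A)))"
      using f A by (intro prod.cong refl, subst emeasure_uniform_count_measure) auto
    also have "\<dots> = ennreal (1 / real (card A) ^ card I)"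
      by (simp add: ennreal_power power_one_over)
    also have "\<dots> = emeasure (uniform_count_measure (PiE I (\<lambda>_. A))) {f}"
      using f finite I by (subst emeasure_uniform_count_measure) (auto simp: card_PiE)
    finally show "emeasure (PiM I (\<lambda>_. uniform_count_measure A)) {f}
        = emeasure (uniform_count_measure (PiE I (\<lambda>_. A))) {f}" .
  qed (simp add: sets_uniform_count_measure_count_space)
qed

text \<open>\<open>g\<close> factors through the first \<open>N\<close> coordinates, whose marginal
  is uniform on a finite cube with all subsets measurable; this is where measurability of
  \<open>g\<close> comes from.\<close>

lemma integral_sign_measure:
  fixes g :: "(nat \<Rightarrow> real) \<Rightarrow> real"
  assumes g: "\<And>\<epsilon> \<epsilon>'. (\<And>i. i < N \<Longrightarrow> \<epsilon> i = \<epsilon>' i) \<Longrightarrow> g \<epsilon> = g \<epsilon>'"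
  shows "integral\<^sup>L sign_measure g = sign_avg N g"
proof -
  let ?U = "uniform_count_measure {-1, 1 :: real}"
  interpret U: prob_space ?U
    by (rule prob_space_uniform_count_measure) auto
  interpret product_prob_space "\<lambda>_. ?U" "UNIV :: nat set" ..
  let ?P = "PiE {..<N} (\<lambda>_. {-1, 1 :: real})"
  have finite: "finite ?P"
    by (intro finite_PiE) auto
  have PiM: "PiM {..<N} (\<lambda>_. ?U) = uniform_count_measure ?P"
    by (rule PiM_uniform_count_measure) auto
  have meas: "g \<in> borel_measurable (PiM {..<N} (\<lambda>_. ?U))"
    unfolding PiM by (simp add: measurable_cong_sets[OF sets_uniform_count_measure_count_space refl])
  have "integral\<^sup>L sign_measure g = (\<integral>\<epsilon>. g (restrict \<epsilon> {..<N}) \<partial>sign_measure)"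
    by (intro Bochner_Integration.integral_cong refl g) simp
  also have "\<dots> = integral\<^sup>L (distr sign_measure (PiM {..<N} (\<lambda>_. ?U)) (\<lambda>\<epsilon>. restrict \<epsilon> {..<N})) g"
    unfolding sign_measure_def by (intro integral_distr[symmetric] meas measurable_restrict_subset) simp
  also have "\<dots> = integral\<^sup>L (uniform_count_measure ?P) g"
    unfolding sign_measure_def by (subst distr_PiM_restrict_finite) (simp_all add: PiM)
  also have "\<dots> = (\<Sum>h\<in>?P. g h) / 2 ^ N"
    using finite by (simp add: integral_uniform_count_measure card_PiE numeral_2_eq_2)
  also have "(\<Sum>h\<in>?P. g h) = (\<Sum>h\<in>?P. g (\<lambda>i. if i < N then h i else 1))"
    by (intro sum.cong refl g) simp
  finally show ?thesis
    by (simp add: sign_avg_def signs_reindex_PiE)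
qed

section \<open>Rotation invariance of arc length on the circle\<close>

lemma emeasure_lborel_translate:
  fixes c :: real
  assumes "S \<in> sets borel"
  shows "emeasure lborel {t. t + c \<in> S} = emeasure lborel S"
proof -
  have "emeasure lborel S = emeasure (distr lborel borel ((+) c)) S"
    by (simp add: lborel_distr_plus)
  also have "\<dots> = emeasure lborel {t. t + c \<in> S}"
    using assms by (subst emeasure_distr) (auto simp: vimage_def add.commute)
  finally show ?thesis ..
qed

text \<open>The shifted window \<open>{c<..p + c}\<close> is cut at \<open>p\<close>, and the piece
  beyond \<open>p\<close> is moved back by one period. Half-open intervals make the pieces
  disjoint.\<close>

lemma emeasure_lborel_periodic_shift:
  fixes B :: "real set"
  assumes B: "B \<in> sets borel" and per: "\<And>t. t + p \<in> B \<longleftrightarrow> t \<in> B" and c: "0 \<le> c" "c \<le> p"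
  shows "emeasure lborel {t. 0 < t \<and> t \<le> p \<and> t + c \<in> B} = emeasure lborel {t. 0 < t \<and> t \<le> p \<and> t \<in> B}"
proof -
  have [measurable]: "B \<in> sets borel" by fact
  have "emeasure lborel {t. 0 < t \<and> t \<le> p \<and> t + c \<in> B} = emeasure lborel {t. t + c \<in> {c<..p + c} \<inter> B}"
    by (intro arg_cong[where f = "emeasure lborel"]) auto
  also have "\<dots> = emeasure lborel ({c<..p + c} \<inter> B)"
    by (rule emeasure_lborel_translate) simp
  also have "{c<..p + c} \<inter> B = ({c<..p} \<inter> B) \<union> ({p<..p + c} \<inter> B)"
    using c by auto
  also have "emeasure lborel \<dots> = emeasure lborel ({c<..p} \<inter> B) + emeasure lborel ({p<..p + c} \<inter> B)"
    by (intro plus_emeasure[symmetric]) auto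
  also have "emeasure lborel ({p<..p + c} \<inter> B) = emeasure lborel {t. t + p \<in> {p<..p + c} \<inter> B}"
    by (rule emeasure_lborel_translate[symmetric]) simp
  also have "{t. t + p \<in> {p<..p + c} \<inter> B} = {0<..c} \<inter> B"
    using per by auto
  also have "emeasure lborel ({c<..p} \<inter> B) + emeasure lborel ({0<..c} \<inter> B)
      = emeasure lborel (({c<..p} \<inter> B) \<union> ({0<..c} \<inter> B))"
    by (intro plus_emeasure) auto
  also have "({c<..p} \<inter> B) \<union> ({0<..c} \<inter> B) = {t. 0 < t \<and> t \<le> p \<and> t \<in> B}"
    using c by auto
  finally show ?thesis .
qed

lemma space_circle_measure [simp]: "space circle_measure = sphere 0 1"
  by (simp add: circle_measure_def space_restrict_space)

lemma sets_circle_measure: "sets circle_measure = sets (restrict_space borel (sphere 0 1))"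
  by (simp add: circle_measure_def)

lemma measurable_cis_circle:
  "cis \<in> measurable (uniform_measure lborel {0..2 * pi}) (restrict_space borel (sphere 0 1))"
proof -
  have "cis \<in> borel_measurable borel"
    by (intro borel_measurable_continuous_onI continuous_intros)
  then show ?thesis
    by (intro measurable_restrict_space2) (auto cong: measurable_cong_sets)
qed

lemma prob_space_circle_measure: "prob_space circle_measure"
  unfolding circle_measure_def
  by (intro prob_space.prob_space_distr measurable_cis_circle prob_space_uniform_measure) auto

text \<open>Passing to the half-open period drops the null set \<open>{0}\<close>, so that the
  periodic shift applies.\<close>

lemma emeasure_circle_measure:
  assumes A: "A \<in> sets circle_measure"
  shows "emeasure circle_measure A
    = emeasure lborel {t. 0 < t \<and> t \<le> 2 * pi \<and> t \<in> cis -` A} / emeasure lborel {0..2 * pi}"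
proof -
  have A': "A \<in> sets (restrict_space borel (sphere 0 1))"
    using A by (simp add: sets_circle_measure)
  have cis: "cis -` A \<in> sets borel"
    using measurable_sets[OF measurable_cis_circle A'] by simp
  have "emeasure circle_measure A = emeasure (uniform_measure lborel {0..2 * pi}) (cis -` A)"
    using A' unfolding circle_measure_def
    by (subst emeasure_distr[OF measurable_cis_circle]) auto
  also have "\<dots> = emeasure lborel ({0..2 * pi} \<inter> cis -` A) / emeasure lborel {0..2 * pi}"
    using cis by (subst emeasure_uniform_measure) auto
  also have "emeasure lborel ({0..2 * pi} \<inter> cis -` A) = emeasure lborel {t. 0 < t \<and> t \<le> 2 * pi \<and> t \<in> cis -` A}"
  proof (rule emeasure_eq_AE)
    show "AE t in lborel. t \<in> {0..2 * pi} \<inter> cis -` A \<longleftrightarrow> t \<in> {t. 0 < t \<and> t \<le> 2 * pi \<and> t \<in> cis -` A}"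
      using AE_lborel_singleton[of 0] by eventually_elim auto
    have "{t. 0 < t \<and> t \<le> 2 * pi \<and> t \<in> cis -` A} = {0<..2 * pi} \<inter> cis -` A" by auto
    then show "{t. 0 < t \<and> t \<le> 2 * pi \<and> t \<in> cis -` A} \<in> sets lborel"
      using cis by simp
  qed (use cis in simp)
  finally show ?thesis .
qed

lemma measurable_rotate_circle:
  assumes "cmod w = 1"
  shows "(\<lambda>z. w * z) \<in> measurable circle_measure circle_measure"
proof -
  have "(\<lambda>z. w * z) \<in> measurable (restrict_space borel (sphere 0 1)) (restrict_space borel (sphere 0 1))"
    using assms
    by (intro measurable_restrict_space3 borel_measurable_continuous_onI continuous_intros)
       (auto simp: norm_mult)
  then show ?thesis
    by (simp cong: measurable_cong_sets add: sets_circle_measure)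
qed

text \<open>With \<open>w = cis c\<close>, rotation becomes the shift of the angle by
  \<open>c\<close>, and the preimage of \<open>A\<close> under \<open>cis\<close> has period
  \<open>2 * pi\<close>.\<close>

lemma distr_rotate_circle:
  assumes w: "cmod w = 1"
  shows "distr circle_measure circle_measure (\<lambda>z. w * z) = circle_measure"
proof (rule measure_eqI)
  fix A assume "A \<in> sets (distr circle_measure circle_measure (\<lambda>z. w * z))"
  then have A: "A \<in> sets circle_measure" by simp
  define c where "c = Arg2pi w"
  have c: "0 \<le> c" "c \<le> 2 * pi" "w = cis c"
    using Arg2pi[of w] w by (auto simp: c_def is_Arg_def cis_conv_exp)
  let ?B = "cis -` A"
  have B: "?B \<in> sets borel"
    using measurable_sets[OF measurable_cis_circle] A by (simp add: sets_circle_measure)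
  let ?A = "(\<lambda>z. w * z) -` A \<inter> space circle_measure"
  have A': "?A \<in> sets circle_measure"
    by (rule measurable_sets[OF measurable_rotate_circle[OF w] A])
  have "emeasure (distr circle_measure circle_measure (\<lambda>z. w * z)) A = emeasure circle_measure ?A"
    by (rule emeasure_distr[OF measurable_rotate_circle[OF w] A])
  also have "\<dots> = emeasure lborel {t. 0 < t \<and> t \<le> 2 * pi \<and> t \<in> cis -` ?A} / emeasure lborel {0..2 * pi}"
    by (rule emeasure_circle_measure[OF A'])
  also have "{t. 0 < t \<and> t \<le> 2 * pi \<and> t \<in> cis -` ?A} = {t. 0 < t \<and> t \<le> 2 * pi \<and> t + c \<in> ?B}"
    by (auto simp: c(3) cis_mult add.commute)
  also have "emeasure lborel \<dots> = emeasure lborel {t. 0 < t \<and> t \<le> 2 * pi \<and> t \<in> ?B}"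
    using c B by (intro emeasure_lborel_periodic_shift) (simp_all flip: cis_mult)
  also have "\<dots> / emeasure lborel {0..2 * pi} = emeasure circle_measure A"
    by (rule emeasure_circle_measure[OF A, symmetric])
  finally show "emeasure (distr circle_measure circle_measure (\<lambda>z. w * z)) A = emeasure circle_measure A" .
qed simp

section \<open>Integration on the torus\<close>

lemma prob_space_torus_measure: "prob_space (torus_measure n)"
  unfolding torus_measure_def by (intro prob_space_PiM prob_space_circle_measure)

lemma space_torus_measure: "space (torus_measure n) = PiE {..<n} (\<lambda>_. sphere 0 1)"
  by (simp add: torus_measure_def space_PiM)

text \<open>Values in \<open>'a\<close> need not be separable, so sums of vector-valued functions are awkward to
  measure; measurability of the real integrands comes from continuity on the product space instead.\<close>

lemma borel_measurable_torus:
  fixes f :: "(nat \<Rightarrow> complex) \<Rightarrow> real"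
  assumes "continuous_on UNIV f"
  shows "f \<in> borel_measurable (torus_measure n)"
proof -
  have "(\<lambda>z. z i) \<in> borel_measurable (torus_measure n)" for i
  proof (cases "i < n")
    case True
    have "(\<lambda>z. z i) \<in> measurable (torus_measure n) circle_measure"
      unfolding torus_measure_def using True by (intro measurable_component_singleton) simp
    then have "(\<lambda>z. z i) \<in> measurable (torus_measure n) (restrict_space borel (sphere 0 1))"
      by (simp cong: measurable_cong_sets add: sets_circle_measure)
    then show ?thesis
      by (simp add: measurable_restrict_space2_iff)
  next
    case False
    then have "z i = undefined" if "z \<in> space (torus_measure n)" for z
      using that by (simp add: space_torus_measure PiE_def extensional_def)
    then show ?thesis
      by (subst measurable_cong[where g = "\<lambda>_. undefined"]) auto
  qed
  then have "(\<lambda>z. z) \<in> borel_measurable (torus_measure n)"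
    by (rule measurable_coordinatewise_then_product)
  from measurable_compose[OF this borel_measurable_continuous_onI[OF assms]]
  show ?thesis .
qed

lemma integrable_torus:
  fixes f :: "(nat \<Rightarrow> complex) \<Rightarrow> real"
  assumes "continuous_on UNIV f" and "\<And>z. (\<And>i. i < n \<Longrightarrow> cmod (z i) = 1) \<Longrightarrow> \<bar>f z\<bar> \<le> B"
  shows "integrable (torus_measure n) f"
proof -
  interpret prob_space "torus_measure n" by (rule prob_space_torus_measure)
  show ?thesis
    using assms
    by (intro integrable_const_bound[of _ B] borel_measurable_torus AE_I2)
       (auto simp: space_torus_measure PiE_iff)
qed

text \<open>Rotation preserves the measure of boxes factor by factor, and boxes determine the
  product measure. Points of the product space equal \<open>undefined\<close> from position
  \<open>n\<close> on, so the rotated point has to be restricted; \<open>dep\<close> makes this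
  invisible to \<open>f\<close>.\<close>

lemma integral_torus_rotate:
  fixes f :: "(nat \<Rightarrow> complex) \<Rightarrow> real"
  assumes f: "continuous_on UNIV f"
    and dep: "\<And>z z'. (\<And>i. i < n \<Longrightarrow> z i = z' i) \<Longrightarrow> f z = f z'"
    and w: "\<And>i. i < n \<Longrightarrow> cmod (w i) = 1"
  shows "(\<integral>z. f (\<lambda>i. w i * z i) \<partial>torus_measure n) = (\<integral>z. f z \<partial>torus_measure n)"
proof -
  interpret C: prob_space circle_measure by (rule prob_space_circle_measure)
  interpret product_prob_space "\<lambda>_. circle_measure" "{..<n}" ..
  let ?T = "torus_measure n" and ?R = "\<lambda>z. \<lambda>i\<in>{..<n}. w i * z i"
  have meas: "?R \<in> measurable ?T ?T"
    unfolding torus_measure_def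
    by (rule measurable_restrict, rule measurable_compose[where g = "\<lambda>u. w _ * u"])
       (auto intro: measurable_component_singleton measurable_rotate_circle w)
  have "distr ?T ?T ?R = ?T"
    unfolding torus_measure_def
  proof (rule PiM_eqI)
    fix A assume A: "\<And>i. i \<in> {..<n} \<Longrightarrow> A i \<in> sets circle_measure"
    let ?A = "\<lambda>i. (\<lambda>z. w i * z) -` A i \<inter> space circle_measure"
    have "emeasure (distr (PiM {..<n} (\<lambda>_. circle_measure)) (PiM {..<n} (\<lambda>_. circle_measure)) ?R) (PiE {..<n} A)
        = emeasure (PiM {..<n} (\<lambda>_. circle_measure)) (?R -` PiE {..<n} A \<inter> space (PiM {..<n} (\<lambda>_. circle_measure)))"
      using A meas unfolding torus_measure_def by (intro emeasure_distr sets_PiM_I_finite) auto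
    also have "?R -` PiE {..<n} A \<inter> space (PiM {..<n} (\<lambda>_. circle_measure)) = PiE {..<n} ?A"
      by (auto simp: space_PiM PiE_iff)
    also have "emeasure (PiM {..<n} (\<lambda>_. circle_measure)) \<dots> = (\<Prod>i<n. emeasure circle_measure (?A i))"
      using A w by (intro emeasure_PiM measurable_sets[OF measurable_rotate_circle]) auto
    also have "\<dots> = (\<Prod>i<n. emeasure circle_measure (A i))"
    proof (intro prod.cong refl)
      fix i assume "i \<in> {..<n}"
      then have "emeasure circle_measure (?A i) = emeasure (distr circle_measure circle_measure (\<lambda>z. w i * z)) (A i)"
        using A w by (intro emeasure_distr[symmetric] measurable_rotate_circle) auto
      then show "emeasure circle_measure (?A i) = emeasure circle_measure (A i)"
        using w \<open>i \<in> {..<n}\<close> by (simp add: distr_rotate_circle)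
    qed
    finally show "emeasure (distr (PiM {..<n} (\<lambda>_. circle_measure)) (PiM {..<n} (\<lambda>_. circle_measure)) ?R) (PiE {..<n} A)
        = (\<Prod>i<n. emeasure circle_measure (A i))" .
  qed auto
  then have "(\<integral>z. f z \<partial>?T) = (\<integral>z. f z \<partial>distr ?T ?T ?R)" by simp
  also have "\<dots> = (\<integral>z. f (?R z) \<partial>?T)"
    by (intro integral_distr meas borel_measurable_torus f)
  also have "\<dots> = (\<integral>z. f (\<lambda>i. w i * z i) \<partial>?T)"
    by (intro Bochner_Integration.integral_cong refl dep) simp
  finally show ?thesis ..
qed

section \<open>The equivalences\<close>

lemma bounded_linear_scaleC_left: "bounded_linear (\<lambda>a. a *\<^sub>C (x :: 'a::complex_banach))"
proof
  show "(a + b) *\<^sub>C x = a *\<^sub>C x + b *\<^sub>C x" for a b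
    by (rule scaleC_add_left)
  show "(r *\<^sub>R a) *\<^sub>C x = r *\<^sub>R a *\<^sub>C x" for r a
    by (subst scaleR_conv_of_real) (simp only: scaleR_scaleC scaleC_scaleC)
  show "\<exists>K. \<forall>a. norm (a *\<^sub>C x) \<le> cmod a * K"
    by (intro exI[of _ "norm x"]) (simp add: norm_scaleC)
qed

lemma bounded_linear_scaleC_right: "bounded_linear (\<lambda>x :: 'a::complex_banach. a *\<^sub>C x)"
proof
  show "a *\<^sub>C (x + y) = a *\<^sub>C x + a *\<^sub>C y" for x y :: 'a
    by (rule scaleC_add_right)
  show "a *\<^sub>C (r *\<^sub>R x) = r *\<^sub>R a *\<^sub>C x" for r and x :: 'a
    by (simp add: scaleR_scaleC scaleC_scaleC mult.commute)
  show "\<exists>K. \<forall>x :: 'a. norm (a *\<^sub>C x) \<le> norm x * K"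
    by (intro exI[of _ "cmod a"]) (simp add: norm_scaleC mult.commute)
qed

lemmas scaleC_sum_left = linear_sum[OF bounded_linear.linear[OF bounded_linear_scaleC_left]]
lemmas scaleC_sum_right = linear_sum[OF bounded_linear.linear[OF bounded_linear_scaleC_right]]
lemmas scaleC_zero_right = linear_0[OF bounded_linear.linear[OF bounded_linear_scaleC_right]]

lemma continuous_on_norm_sum_scaleC_powr:
  fixes x :: "'j \<Rightarrow> 'a::complex_banach" and q :: real
  assumes "0 < q" and "\<And>j. j \<in> S \<Longrightarrow> continuous_on UNIV (p j)"
  shows "continuous_on UNIV (\<lambda>z. norm (\<Sum>j\<in>S. p j z *\<^sub>C x j) powr q)"
  using assms
  by (intro continuous_on_powr' continuous_on_norm continuous_on_sum continuous_on_const
      bounded_linear.continuous_on[OF bounded_linear_scaleC_left]) auto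

lemma continuous_on_monomial_at: "continuous_on UNIV (monomial_at n \<alpha>)"
proof -
  have "continuous_on UNIV (\<lambda>z. \<Prod>i<n. z i ^ \<alpha> i :: complex)"
    by (intro continuous_intros continuous_on_product_coordinates)
  then show ?thesis
    by (simp add: monomial_at_def[abs_def])
qed

lemma continuous_on_rotate:
  fixes f :: "(nat \<Rightarrow> complex) \<Rightarrow> real"
  assumes "continuous_on UNIV f"
  shows "continuous_on UNIV (\<lambda>z. f (\<lambda>i. w i * z i))"
proof -
  have "continuous_on UNIV (\<lambda>(z :: nat \<Rightarrow> complex) i. w i * z i)"
    by (intro continuous_on_coordinatewise_then_product continuous_intros continuous_on_product_coordinates)
  then show ?thesis
    using continuous_on_compose2[OF assms] by blast
qed

lemma norm_sum_scaleC_powr_le: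
  fixes x :: "'j \<Rightarrow> 'a::complex_banach" and q :: real
  assumes "0 \<le> q" and "\<And>j. j \<in> S \<Longrightarrow> cmod (a j) \<le> 1"
  shows "norm (\<Sum>j\<in>S. a j *\<^sub>C x j) powr q \<le> (\<Sum>j\<in>S. norm (x j)) powr q"
  using assms
  by (intro powr_mono2 order_trans[OF norm_sum] sum_mono)
     (auto simp: norm_scaleC intro!: mult_left_le_one_le)

text \<open>Links the form with roots, in which the inequalities are stated, to the form with
  \<open>q\<close>-th powers, in which the estimates are made.\<close>

lemma powr_root_le_iff:
  fixes S I C q :: real
  assumes "0 \<le> S" "0 \<le> I" "0 < C" "0 < q"
  shows "S powr (1 / q) \<le> C ^ m * I powr (1 / q) \<longleftrightarrow> S \<le> (C powr q) ^ m * I"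
proof -
  have "(C powr q) ^ m = (C ^ m) powr q"
    using assms by (simp add: powr_powr mult.commute flip: powr_realpow)
  then have "C ^ m * I powr (1 / q) = ((C powr q) ^ m * I) powr (1 / q)"
    using assms by (simp add: powr_mult powr_powr)
  moreover have "S powr (1 / q) \<le> T powr (1 / q) \<longleftrightarrow> S \<le> T" if "0 \<le> T" for T
    using assms that powr_mono2[of "1 / q" S T] powr_less_mono2[of "1 / q" T S] by force
  ultimately show ?thesis
    using assms by simp
qed

subsection \<open>From cotype to Walsh polynomials\<close>

text \<open>A linear form in the signs is a Walsh polynomial supported on singletons.\<close>

lemma sign_avg_contraction_linear:
  fixes x :: "nat \<Rightarrow> 'a::real_normed_vector" and q :: real
  assumes q: "1 \<le> q" and \<rho>: "\<And>i. \<bar>\<rho> i\<bar> \<le> 1"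
  shows "sign_avg N (\<lambda>\<epsilon>. norm (\<Sum>i<N. (\<rho> i * \<epsilon> i) *\<^sub>R x i) powr q)
    \<le> sign_avg N (\<lambda>\<epsilon>. norm (\<Sum>i<N. \<epsilon> i *\<^sub>R x i) powr q)"
proof -
  have eq: "(\<Sum>A\<in>(\<lambda>i. {i}) ` {..<N}. (\<Prod>i\<in>A. h i) *\<^sub>R x (the_elem A)) = (\<Sum>i<N. h i *\<^sub>R x i)"
    for h :: "nat \<Rightarrow> real"
    by (subst sum.reindex) (auto simp: inj_on_def)
  show ?thesis
    using sign_avg_contraction[OF q, of "(\<lambda>i. {i}) ` {..<N}" N \<rho> "\<lambda>A. x (the_elem A)"] \<rho>
    unfolding eq by auto
qed

text \<open>Real and imaginary parts of \<open>z\<close> are real multipliers of modulus at most one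
  and are contracted separately. Jensen over the two terms gives \<open>2 powr (q - 1)\<close>, and
  the two equal bounds make it \<open>2 powr q\<close>.\<close>

lemma sign_avg_contraction_complex:
  fixes x :: "nat \<Rightarrow> 'a::complex_banach" and q :: real
  assumes q: "1 \<le> q" and z: "\<And>i. i < N \<Longrightarrow> cmod (z i) \<le> 1"
  shows "sign_avg N (\<lambda>\<epsilon>. norm (\<Sum>i<N. (of_real (\<epsilon> i) * z i) *\<^sub>C x i) powr q)
    \<le> 2 powr q * sign_avg N (\<lambda>\<epsilon>. norm (\<Sum>i<N. \<epsilon> i *\<^sub>R x i) powr q)"
proof -
  let ?E = "sign_avg N (\<lambda>\<epsilon>. norm (\<Sum>i<N. \<epsilon> i *\<^sub>R x i) powr q)"
  define \<rho> where "\<rho> j i = (if i < N then (if j then Re (z i) else Im (z i)) else 0)" for j i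
  define v where "v j \<epsilon> = (\<Sum>i<N. (\<rho> j i * \<epsilon> i) *\<^sub>R x i)" for j and \<epsilon> :: "nat \<Rightarrow> real"
  have \<rho>: "\<bar>\<rho> j i\<bar> \<le> 1" for j i
    using z[of i] abs_Re_le_cmod[of "z i"] abs_Im_le_cmod[of "z i"] by (auto simp: \<rho>_def)
  have "norm (\<Sum>i<N. (of_real (\<epsilon> i) * z i) *\<^sub>C x i) powr q
      \<le> 2 powr (q - 1) * (norm (v True \<epsilon>) powr q + norm (v False \<epsilon>) powr q)" for \<epsilon>
  proof -
    have "(of_real (\<epsilon> i) * z i) *\<^sub>C x i = (\<rho> True i * \<epsilon> i) *\<^sub>R x i + \<i> *\<^sub>C (\<rho> False i * \<epsilon> i) *\<^sub>R x i"
      if "i < N" for i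
    proof -
      have "of_real (\<epsilon> i) * z i = of_real (\<rho> True i * \<epsilon> i) + \<i> * of_real (\<rho> False i * \<epsilon> i)"
        using that by (simp add: \<rho>_def complex_eq_iff)
      then show ?thesis
        by (simp only: scaleC_add_left scaleR_scaleC scaleC_scaleC)
    qed
    then have "(\<Sum>i<N. (of_real (\<epsilon> i) * z i) *\<^sub>C x i) = v True \<epsilon> + \<i> *\<^sub>C v False \<epsilon>"
      by (simp add: v_def sum.distrib scaleC_sum_right)
    then show ?thesis
      using norm_weighted_sum_powr_le[OF finite[of UNIV] q, of "\<lambda>_. 1"
          "\<lambda>j. if j then v True \<epsilon> else \<i> *\<^sub>C v False \<epsilon>"]
      by (simp add: UNIV_bool norm_scaleC add.commute)
  qed
  then have "sign_avg N (\<lambda>\<epsilon>. norm (\<Sum>i<N. (of_real (\<epsilon> i) * z i) *\<^sub>C x i) powr q)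
      \<le> sign_avg N (\<lambda>\<epsilon>. 2 powr (q - 1) * (\<Sum>j\<in>UNIV. norm (v j \<epsilon>) powr q))"
    by (intro sign_avg_mono) (simp add: UNIV_bool add.commute)
  also have "\<dots> = 2 powr (q - 1) * (\<Sum>j\<in>UNIV. sign_avg N (\<lambda>\<epsilon>. norm (v j \<epsilon>) powr q))"
    by (simp only: sign_avg_cmult sign_avg_sum)
  also have "\<dots> \<le> 2 powr (q - 1) * (\<Sum>j\<in>(UNIV :: bool set). ?E)"
    unfolding v_def by (intro mult_left_mono sum_mono sign_avg_contraction_linear q \<rho>) simp
  also have "\<dots> = 2 powr q * ?E"
    by (simp add: powr_diff)
  finally show ?thesis .
qed

lemma cotype_imp_rademacher_cotype:
  fixes q :: real
  assumes q: "1 \<le> q" and cotype: "cotype q TYPE('a::complex_banach)"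
  obtains R where "1 \<le> R" and "\<And>N (x :: nat \<Rightarrow> 'a). (\<Sum>i<N. norm (x i) powr q)
      \<le> R * sign_avg N (\<lambda>\<epsilon>. norm (\<Sum>i<N. \<epsilon> i *\<^sub>R x i) powr q)"
proof -
  obtain C where C: "1 \<le> C" and ineq: "\<And>N (x :: nat \<Rightarrow> 'a).
      (\<Sum>k<N. norm (x k) powr q) powr (1 / q)
        \<le> C * (\<integral>z. norm (\<Sum>k<N. z k *\<^sub>C x k) powr q \<partial>torus_measure N) powr (1 / q)"
    using cotype unfolding cotype_def by blast
  show thesis
  proof (rule that)
    show "1 \<le> C powr q * 2 powr q"
      using C q ge_one_powr_ge_zero[of C q] ge_one_powr_ge_zero[of 2 q] by (simp add: mult_ge1_I)
    fix N and x :: "nat \<Rightarrow> 'a"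
    define f where "f z = norm (\<Sum>k<N. z k *\<^sub>C x k) powr q" for z
    let ?E = "sign_avg N (\<lambda>\<epsilon>. norm (\<Sum>i<N. \<epsilon> i *\<^sub>R x i) powr q)"
    interpret prob_space "torus_measure N" by (rule prob_space_torus_measure)
    have cont: "continuous_on UNIV f"
      unfolding f_def using q
      by (intro continuous_on_norm_sum_scaleC_powr continuous_on_product_coordinates) auto
    have dep: "f z = f z'" if "\<And>i. i < N \<Longrightarrow> z i = z' i" for z z'
      using that by (simp add: f_def)
    have integrable: "integrable (torus_measure N) (\<lambda>z. f (\<lambda>i. of_real (\<epsilon> i) * z i))"
      if \<epsilon>: "\<epsilon> \<in> signs N" for \<epsilon>
      using \<epsilon> q unfolding f_def
      by (intro integrable_torus[where B = "(\<Sum>k<N. norm (x k)) powr q"]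
          continuous_on_rotate[OF cont[unfolded f_def]])
         (auto intro!: norm_sum_scaleC_powr_le simp: norm_mult)
    have "integral\<^sup>L (torus_measure N) f = sign_avg N (\<lambda>\<epsilon>. \<integral>z. f (\<lambda>i. of_real (\<epsilon> i) * z i) \<partial>torus_measure N)"
      by (subst sign_avg_const[of N, symmetric], rule sign_avg_cong, rule integral_torus_rotate[symmetric])
         (auto intro: cont dep)
    also have "\<dots> = (\<integral>z. sign_avg N (\<lambda>\<epsilon>. f (\<lambda>i. of_real (\<epsilon> i) * z i)) \<partial>torus_measure N)"
      using integrable by (simp add: sign_avg_def)
    \<comment> \<open>For each fixed \<open>z\<close> the complex contraction removes the
      coordinates of \<open>z\<close>, leaving a bound that is constant on the torus.\<close>
    also have "\<dots> \<le> (\<integral>z. 2 powr q * ?E \<partial>torus_measure N)"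
    proof (rule integral_mono)
      show "integrable (torus_measure N) (\<lambda>z. sign_avg N (\<lambda>\<epsilon>. f (\<lambda>i. of_real (\<epsilon> i) * z i)))"
        unfolding sign_avg_def using integrable by auto
      fix z assume "z \<in> space (torus_measure N)"
      then show "sign_avg N (\<lambda>\<epsilon>. f (\<lambda>i. of_real (\<epsilon> i) * z i)) \<le> 2 powr q * ?E"
        unfolding f_def using q by (intro sign_avg_contraction_complex) (auto simp: space_torus_measure PiE_iff)
    qed simp
    also have "\<dots> = 2 powr q * ?E"
      by (simp add: prob_space)
    finally have "integral\<^sup>L (torus_measure N) f \<le> 2 powr q * ?E" .
    moreover have "(\<Sum>i<N. norm (x i) powr q) \<le> C powr q * integral\<^sup>L (torus_measure N) f"
      using ineq[where N = N and x = x] powr_root_le_iff[of "\<Sum>i<N. norm (x i) powr q" "integral\<^sup>L (torus_measure N) f" C q 1] C q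
      by (simp add: f_def[abs_def] sum_nonneg)
    ultimately show "(\<Sum>i<N. norm (x i) powr q) \<le> C powr q * 2 powr q * ?E"
      by (smt (verit) mult.assoc mult_left_mono powr_ge_zero)
  qed
qed

lemma cotype_imp_walsh_cotype:
  fixes q :: real
  assumes q: "1 \<le> q" and cotype: "cotype q TYPE('a::complex_banach)"
  shows "\<exists>C>0. \<forall>m\<ge>1. \<forall>F. \<forall>x :: nat set \<Rightarrow> 'a.
        finite F \<and> (\<forall>A\<in>F. finite A \<and> card A \<le> m) \<longrightarrow>
        (\<Sum>A\<in>F. norm (x A) powr q) powr (1 / q)
          \<le> C ^ m * (\<integral>\<epsilon>. norm (\<Sum>A\<in>F. (\<Prod>i\<in>A. \<epsilon> i) *\<^sub>R x A) powr q
                        \<partial>sign_measure) powr (1 / q)"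
proof -
  obtain R where R: "1 \<le> R" and rademacher: "\<And>N (x :: nat \<Rightarrow> 'a). (\<Sum>i<N. norm (x i) powr q)
      \<le> R * sign_avg N (\<lambda>\<epsilon>. norm (\<Sum>i<N. \<epsilon> i *\<^sub>R x i) powr q)"
    using cotype_imp_rademacher_cotype[OF assms] by blast
  define C where "C = (6 * R * 12 powr q) powr (1 / q)"
  have C: "0 < C" "C powr q = 6 * R * 12 powr q"
    using R q by (simp_all add: C_def powr_powr)
  show ?thesis
  proof (intro exI[of _ C] conjI allI impI; (elim conjE)?)
    fix m and F :: "nat set set" and x :: "nat set \<Rightarrow> 'a"
    assume m: "1 \<le> m" and F: "finite F" "\<forall>A\<in>F. finite A \<and> card A \<le> m"
    then have "finite (\<Union>F)" by auto
    then obtain N where "\<Union>F \<subseteq> {..<N}"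
      using finite_nat_iff_bounded by blast
    then have N: "A \<subseteq> {..<N} \<and> card A \<le> m" if "A \<in> F" for A
      using that F by auto
    have "(\<integral>\<epsilon>. norm (\<Sum>A\<in>F. (\<Prod>i\<in>A. \<epsilon> i) *\<^sub>R x A) powr q \<partial>sign_measure)
        = sign_avg N (\<lambda>\<epsilon>. norm (\<Sum>A\<in>F. (\<Prod>i\<in>A. \<epsilon> i) *\<^sub>R x A) powr q)"
      using N
      by (intro integral_sign_measure arg_cong[where f = "\<lambda>v. norm v powr q"] sum.cong refl
          arg_cong2[where f = "(*\<^sub>R)"] prod.cong) auto
    then show "(\<Sum>A\<in>F. norm (x A) powr q) powr (1 / q)
        \<le> C ^ m * (\<integral>\<epsilon>. norm (\<Sum>A\<in>F. (\<Prod>i\<in>A. \<epsilon> i) *\<^sub>R x A) powr q \<partial>sign_measure) powr (1 / q)"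
      using sum_walsh_le[OF q R rademacher N m] q C
      by (subst powr_root_le_iff) (auto intro: sum_nonneg sign_avg_nonneg)
  qed (use C in simp)
qed

subsection \<open>From Walsh polynomials to polynomials on the torus\<close>

text \<open>For \<open>b \<noteq> 0\<close> the sum is geometric with ratio \<open>u\<close>, where
  \<open>u ^ M = 1\<close>; \<open>u = 1\<close> would make \<open>M\<close> divide
  \<open>b\<close>, against \<open>\<bar>b\<bar> < M\<close>.\<close>

lemma sum_cis_eq:
  fixes b :: int
  assumes b: "\<bar>b\<bar> < int M"
  shows "(\<Sum>s<M. cis (2 * pi * (of_int b * real s) / real M)) = (if b = 0 then of_nat M else 0)"
proof (cases "b = 0")
  case False
  define u where "u = cis (2 * pi * of_int b / real M)"
  have M: "M > 0" using b by (cases M) auto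
  have pow: "cis (2 * pi * (of_int b * real s) / real M) = u ^ s" for s
    by (simp add: u_def Complex.DeMoivre mult_ac)
  have "u \<noteq> 1"
  proof
    assume "u = 1"
    then have "cos (2 * pi * of_int b / real M) = 1"
      by (metis cis.simps(1) one_complex.simps(1) u_def)
    then obtain n :: int where "2 * pi * of_int b / real M = of_int n * 2 * pi"
      using cos_one_2pi_int by blast
    then have "real_of_int b = of_int (n * int M)"
      using M by (simp add: field_simps)
    then have "b = n * int M"
      by (simp only: of_int_eq_iff)
    then show False
      using b False by (auto simp: abs_mult)
  qed
  moreover have "u ^ M = 1"
    using M cis_multiple_2pi[of "of_int b"] by (simp add: u_def Complex.DeMoivre mult_ac)
  ultimately show ?thesis
    using False by (simp add: pow geometric_sum)
qed simp

lemma cos_conv_cis: "complex_of_real (cos t) = (cis t + cis (- t)) / 2"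
  by (simp add: complex_eq_iff)

text \<open>The discrete Riesz-type kernel on the \<open>(2 * m + 1)\<close>-th roots of unity. It is positive because the
  coefficients \<open>1 / 2 ^ l\<close> have sum less than one; its moments of order at most \<open>m\<close> carry a separate
  sign for every exponent.\<close>

definition riesz_kernel :: "nat \<Rightarrow> (nat \<Rightarrow> real) \<Rightarrow> nat \<Rightarrow> real" where
  "riesz_kernel m e s = (1 + (\<Sum>l\<in>{1..m}. e l / 2 ^ l * cos (2 * pi * (real l * real s) / real (2 * m + 1)))) / real (2 * m + 1)"

lemma riesz_kernel_nonneg:
  assumes "\<And>l. \<bar>e l\<bar> \<le> 1"
  shows "0 \<le> riesz_kernel m e s"
proof -
  have "\<bar>\<Sum>l\<in>{1..m}. e l / 2 ^ l * cos (2 * pi * (real l * real s) / real (2 * m + 1))\<bar> \<le> (\<Sum>l\<in>{1..m}. 1 / 2 ^ l)"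
  proof (rule order_trans[OF sum_abs sum_mono])
    fix l
    have "\<bar>e l\<bar> * \<bar>cos (2 * pi * (real l * real s) / real (2 * m + 1))\<bar> \<le> 1 * 1"
      using assms by (intro mult_mono) auto
    then show "\<bar>e l / 2 ^ l * cos (2 * pi * (real l * real s) / real (2 * m + 1))\<bar> \<le> 1 / 2 ^ l"
      by (simp add: abs_mult divide_right_mono)
  qed
  also have "(\<Sum>l\<in>{1..m}. 1 / 2 ^ l) = (1 - 1 / 2 ^ m :: real)" for m
    by (induction m) (auto simp: field_simps)
  finally show ?thesis
    unfolding riesz_kernel_def by (intro divide_nonneg_nonneg) (smt (verit) divide_nonneg_nonneg zero_le_power, simp)
qed

text \<open>Orthogonality of characters. The frequencies \<open>a + l\<close> and
  \<open>a - l\<close> have modulus at most \<open>2 * m\<close>, which is why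
  \<open>2 * m + 1\<close> points suffice; besides the constant term of the kernel, which matters
  for \<open>a = 0\<close>, only \<open>l = a\<close> survives. The exponent \<open>a + 1\<close>
  instead of \<open>a\<close> comes from the \<open>1 / 2\<close> in the cosine.\<close>

lemma riesz_kernel_moment:
  assumes a: "a \<le> m"
  shows "(\<Sum>s<2 * m + 1. of_real (riesz_kernel m e s) * cis (2 * pi * real s / real (2 * m + 1)) ^ a)
    = of_real (if a = 0 then 1 else e a / 2 ^ (a + 1))"
proof -
  define M where "M = 2 * m + 1"
  define ch where "ch b s = cis (2 * pi * (of_int b * real s) / real M)" for b :: int and s :: nat
  have ch_sum: "(\<Sum>s<M. ch b s) = (if b = 0 then of_nat M else 0)" if "\<bar>b\<bar> \<le> 2 * int m" for b
    using sum_cis_eq[of b M] that by (simp add: ch_def M_def)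
  have ch_diff_sum: "(\<Sum>s<M. ch (int a - int l) s) = (if l = a then of_nat M else 0)" if "l \<le> m" for l
    using ch_sum[of "int a - int l"] that a by auto
  have ch_add: "ch b s * ch b' s = ch (b + b') s" for b b' s
    by (simp add: ch_def cis_mult ring_distribs add_divide_distrib)
  have shift: "ch (int a) s * (u * (ch (int l) s + ch (- int l) s)) = u * (ch (int a + int l) s + ch (int a - int l) s)"
    for u l s
    using ch_add[of "int a" s "int l"] ch_add[of "int a" s "- int l"]
    by (simp add: distrib_left mult.left_commute)
  have pow: "cis (2 * pi * real s / real M) ^ a = ch (int a) s" for s
    by (simp add: ch_def Complex.DeMoivre mult_ac)
  have cos: "complex_of_real (cos (2 * pi * (real l * real s) / real M)) = (ch (int l) s + ch (- int l) s) / 2" for l s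
    by (simp add: ch_def cos_conv_cis)
  have "(\<Sum>s<M. of_real (riesz_kernel m e s) * cis (2 * pi * real s / real M) ^ a)
      = (\<Sum>s<M. ch (int a) s + (\<Sum>l\<in>{1..m}. of_real (e l / 2 ^ (l + 1)) * (ch (int a + int l) s + ch (int a - int l) s))) / of_nat M"
    unfolding sum_divide_distrib
  proof (rule sum.cong[OF refl])
    fix s
    have "of_real (riesz_kernel m e s) = (1 + (\<Sum>l\<in>{1..m}. of_real (e l / 2 ^ (l + 1)) * (ch (int l) s + ch (- int l) s))) / of_nat M"
      unfolding riesz_kernel_def M_def[symmetric] of_real_divide of_real_add of_real_sum of_real_mult cos by (simp add: mult_ac)
    then have "of_real (riesz_kernel m e s) * cis (2 * pi * real s / real M) ^ a
        = ch (int a) s * (1 + (\<Sum>l\<in>{1..m}. of_real (e l / 2 ^ (l + 1)) * (ch (int l) s + ch (- int l) s))) / of_nat M"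
      unfolding pow by (simp only: times_divide_eq_left times_divide_eq_right mult.commute)
    also have "ch (int a) s * (1 + (\<Sum>l\<in>{1..m}. of_real (e l / 2 ^ (l + 1)) * (ch (int l) s + ch (- int l) s)))
        = ch (int a) s + (\<Sum>l\<in>{1..m}. of_real (e l / 2 ^ (l + 1)) * (ch (int a + int l) s + ch (int a - int l) s))"
      by (simp only: distrib_left[of "ch (int a) s" 1] sum_distrib_left shift mult_1_right)
    finally show "of_real (riesz_kernel m e s) * cis (2 * pi * real s / real M) ^ a
        = (ch (int a) s + (\<Sum>l\<in>{1..m}. of_real (e l / 2 ^ (l + 1)) * (ch (int a + int l) s + ch (int a - int l) s))) / of_nat M" .
  qed
  also have "(\<Sum>s<M. ch (int a) s + (\<Sum>l\<in>{1..m}. of_real (e l / 2 ^ (l + 1)) * (ch (int a + int l) s + ch (int a - int l) s)))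
      = (\<Sum>s<M. ch (int a) s) + (\<Sum>l\<in>{1..m}. of_real (e l / 2 ^ (l + 1)) * ((\<Sum>s<M. ch (int a + int l) s) + (\<Sum>s<M. ch (int a - int l) s)))"
    unfolding sum.distrib by (subst sum.swap) (simp only: sum_distrib_left[symmetric] sum.distrib)
  also have "\<dots> = (if a = 0 then of_nat M else 0) + (\<Sum>l\<in>{1..m}. if l = a then of_real (e l / 2 ^ (l + 1)) * of_nat M else 0)"
    using a by (intro arg_cong2[where f = "(+)"] sum.cong refl) (simp_all add: ch_sum ch_diff_sum)
  also have "\<dots> / of_nat M = of_real (if a = 0 then 1 else e a / 2 ^ (a + 1))"
    using a by (auto simp: sum.delta M_def simp del: of_nat_add of_nat_mult of_nat_Suc)
  finally show ?thesis
    unfolding M_def .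
qed

text \<open>The argument is pointwise in \<open>z\<close>: the monomials are absorbed into the
  coefficients without changing norms, and the Walsh inequality is applied to the kernel average of
  rotated values. Integration over \<open>z\<close> comes last and removes the rotations.\<close>

lemma walsh_imp_torus_cotype:
  fixes q :: real
  assumes q: "1 \<le> q"
    and walsh: "\<exists>C>0. \<forall>m\<ge>1. \<forall>F. \<forall>x :: nat set \<Rightarrow> 'a::complex_banach.
        finite F \<and> (\<forall>A\<in>F. finite A \<and> card A \<le> m) \<longrightarrow>
        (\<Sum>A\<in>F. norm (x A) powr q) powr (1 / q)
          \<le> C ^ m * (\<integral>\<epsilon>. norm (\<Sum>A\<in>F. (\<Prod>i\<in>A. \<epsilon> i) *\<^sub>R x A) powr q
                        \<partial>sign_measure) powr (1 / q)" (is "\<exists>C>0. ?P C")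
  shows "\<exists>C>0. \<forall>m\<ge>1. \<forall>n. \<forall>x :: (nat \<Rightarrow> nat) \<Rightarrow> 'a.
        (\<Sum>\<alpha>\<in>multi_indices n m. norm (x \<alpha>) powr q) powr (1 / q)
          \<le> C ^ m * (\<integral>z. norm (\<Sum>\<alpha>\<in>multi_indices n m. monomial_at n \<alpha> z *\<^sub>C x \<alpha>) powr q
                        \<partial>torus_measure n) powr (1 / q)"
proof -
  obtain C where C: "C > 0" and "?P C"
    using walsh by blast
  then have ineq: "(\<Sum>A\<in>F. norm (x A) powr q) powr (1 / q)
        \<le> C ^ m * (\<integral>\<epsilon>. norm (\<Sum>A\<in>F. (\<Prod>i\<in>A. \<epsilon> i) *\<^sub>R x A) powr q \<partial>sign_measure) powr (1 / q)"
    if "1 \<le> m" "finite F" "\<And>A. A \<in> F \<Longrightarrow> finite A \<and> card A \<le> m" for m F and x :: "nat set \<Rightarrow> 'a"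
    using that by simp
  show ?thesis
  proof (intro exI[of _ "4 * C"] conjI allI impI)
    show "0 < 4 * C" using C by simp
    fix m n :: nat and x :: "(nat \<Rightarrow> nat) \<Rightarrow> 'a"
    assume m: "1 \<le> m"
    let ?S = "multi_indices n m" and ?M = "2 * m + 1"
    have le_m: "\<alpha> i \<le> m" if "\<alpha> \<in> ?S" "i < n" for \<alpha> i
      using that member_le_sum[of i "{..<n}" \<alpha>] by (auto simp: multi_indices_def)
    define supp where "supp \<alpha> = {i. i < n \<and> \<alpha> i \<noteq> 0}" for \<alpha> :: "nat \<Rightarrow> nat"
    \<comment> \<open>The set records each nonzero exponent with its position, so it determines
      \<open>\<alpha>\<close>; leaving out zero exponents keeps it at no more than \<open>m\<close>
      elements.\<close>
    define T where "T \<alpha> = (\<lambda>i. prod_encode (i, \<alpha> i)) ` supp \<alpha>" for \<alpha>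
    define d where "d \<alpha> = (\<Prod>i\<in>supp \<alpha>. 1 / 2 ^ (\<alpha> i + 1) :: real)" for \<alpha>
    have fin_supp [simp]: "finite (supp \<alpha>)" for \<alpha>
      by (simp add: supp_def)
    have sum_supp: "(\<Sum>i\<in>supp \<alpha>. \<alpha> i) \<le> m" if "\<alpha> \<in> ?S" for \<alpha>
    proof -
      have "(\<Sum>i\<in>supp \<alpha>. \<alpha> i) \<le> (\<Sum>i<n. \<alpha> i)"
        by (intro sum_mono2) (auto simp: supp_def)
      then show ?thesis
        using that by (simp add: multi_indices_def)
    qed
    have T_card: "finite (T \<alpha>) \<and> card (T \<alpha>) \<le> m" if "\<alpha> \<in> ?S" for \<alpha>
    proof -
      have "card (supp \<alpha>) = (\<Sum>i\<in>supp \<alpha>. 1)" by simp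
      also have "\<dots> \<le> (\<Sum>i\<in>supp \<alpha>. \<alpha> i)"
        by (intro sum_mono) (auto simp: supp_def)
      finally show ?thesis
        using sum_supp[OF that] card_image_le[of "supp \<alpha>" "\<lambda>i. prod_encode (i, \<alpha> i)"]
        by (auto simp: T_def)
    qed
    have T_mem: "prod_encode (i, l) \<in> T \<alpha> \<longleftrightarrow> i < n \<and> \<alpha> i = l \<and> l \<noteq> 0" for i l \<alpha>
      by (auto simp: T_def supp_def)
    have T_inj: "inj_on T ?S"
    proof (rule inj_onI, rule ext)
      fix \<alpha> \<beta> i assume *: "\<alpha> \<in> ?S" "\<beta> \<in> ?S" "T \<alpha> = T \<beta>"
      show "\<alpha> i = \<beta> i"
      proof (cases "i < n")
        case True
        then show ?thesis
          using T_mem[of i "\<alpha> i" \<alpha>] T_mem[of i "\<alpha> i" \<beta>] T_mem[of i "\<beta> i" \<alpha>] T_mem[of i "\<beta> i" \<beta>] *(3)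
          by (metis)
      qed (use * in \<open>simp add: multi_indices_def\<close>)
    qed
    \<comment> \<open>On the support \<open>\<alpha> i + 1 \<le> 2 * \<alpha> i\<close>, so each
      factor of \<open>d \<alpha>\<close> is at least \<open>(1 / 4) ^ \<alpha> i\<close>.\<close>
    have d_ge: "(1 / 4) ^ m \<le> d \<alpha>" if "\<alpha> \<in> ?S" for \<alpha>
    proof -
      have "(1 / 4 :: real) ^ m \<le> (1 / 4) ^ (\<Sum>i\<in>supp \<alpha>. \<alpha> i)"
        using sum_supp[OF that] by (intro power_decreasing) auto
      also have "\<dots> = (\<Prod>i\<in>supp \<alpha>. (1 / 4) ^ \<alpha> i)"
        by (simp add: power_sum)
      also have "\<dots> \<le> d \<alpha>"
        unfolding d_def
      proof (intro prod_mono conjI)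
        fix i assume "i \<in> supp \<alpha>"
        then have "\<alpha> i + 1 \<le> 2 * \<alpha> i" by (auto simp: supp_def)
        then have "(1 / 2 :: real) ^ (2 * \<alpha> i) \<le> (1 / 2) ^ (\<alpha> i + 1)"
          by (intro power_decreasing) auto
        then show "(1 / 4 :: real) ^ \<alpha> i \<le> 1 / 2 ^ (\<alpha> i + 1)"
          by (simp add: power_mult power_one_over power2_eq_square)
      qed simp
      finally show ?thesis .
    qed
    define f where "f z = norm (\<Sum>\<alpha>\<in>?S. monomial_at n \<alpha> z *\<^sub>C x \<alpha>) powr q" for z
    define \<omega> where "\<omega> t i = cis (2 * pi * real (t i) / real ?M)" for t :: "nat \<Rightarrow> nat" and i
    \<comment> \<open>Each coordinate uses its own block of signs, and the moments of the product
      kernel factor over \<open>i\<close>.\<close>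
    define \<kappa> where "\<kappa> \<epsilon> t = (\<Prod>i<n. riesz_kernel m (\<lambda>l. \<epsilon> (prod_encode (i, l))) (t i))"
      for \<epsilon> :: "nat \<Rightarrow> real" and t
    define P where "P = PiE {..<n} (\<lambda>_. {..<?M})"
    have finP: "finite P"
      unfolding P_def by (intro finite_PiE) auto
    have norm_monomial: "cmod (monomial_at n \<alpha> z) = 1" if "\<And>i. i < n \<Longrightarrow> cmod (z i) = 1" for \<alpha> z
      using that by (simp add: monomial_at_def norm_power flip: prod_norm)
    have moment: "(\<Sum>t\<in>P. of_real (\<kappa> \<epsilon> t) * monomial_at n \<alpha> (\<omega> t)) = of_real ((\<Prod>a\<in>T \<alpha>. \<epsilon> a) * d \<alpha>)"
      if "\<alpha> \<in> ?S" for \<alpha> \<epsilon>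
    proof -
      have "(\<Sum>t\<in>P. of_real (\<kappa> \<epsilon> t) * monomial_at n \<alpha> (\<omega> t))
          = (\<Prod>i<n. \<Sum>s<?M. of_real (riesz_kernel m (\<lambda>l. \<epsilon> (prod_encode (i, l))) s) * cis (2 * pi * real s / real ?M) ^ \<alpha> i)"
        unfolding P_def by (subst prod_sum_PiE) (auto simp: \<kappa>_def monomial_at_def \<omega>_def prod.distrib)
      also have "\<dots> = (\<Prod>i<n. of_real (if \<alpha> i = 0 then 1 else \<epsilon> (prod_encode (i, \<alpha> i)) / 2 ^ (\<alpha> i + 1)))"
        by (intro prod.cong refl riesz_kernel_moment le_m that) simp
      also have "\<dots> = of_real (\<Prod>i<n. if \<alpha> i = 0 then 1 else \<epsilon> (prod_encode (i, \<alpha> i)) / 2 ^ (\<alpha> i + 1))"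
        by (rule of_real_prod[symmetric])
      also have "(\<Prod>i<n. if \<alpha> i = 0 then 1 else \<epsilon> (prod_encode (i, \<alpha> i)) / 2 ^ (\<alpha> i + 1))
          = (\<Prod>i\<in>supp \<alpha>. \<epsilon> (prod_encode (i, \<alpha> i)) / 2 ^ (\<alpha> i + 1))"
        by (intro prod.mono_neutral_cong_right) (auto simp: supp_def)
      also have "\<dots> = (\<Prod>a\<in>T \<alpha>. \<epsilon> a) * d \<alpha>"
        by (simp add: T_def d_def prod.reindex inj_on_def prod_dividef)
      finally show ?thesis .
    qed
    \<comment> \<open>The moment of the constant monomial is the total mass of
      \<open>\<kappa>\<close>.\<close>
    have zero: "(\<lambda>_. 0) \<in> ?S"
      by (simp add: multi_indices_def)
    have \<kappa>_total: "(\<Sum>t\<in>P. \<kappa> \<epsilon> t) = 1" for \<epsilon>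
    proof -
      have "complex_of_real (\<Sum>t\<in>P. \<kappa> \<epsilon> t) = 1"
        using moment[OF zero, of \<epsilon>] by (simp add: monomial_at_def T_def d_def supp_def)
      then show ?thesis
        by (simp only: of_real_eq_1_iff)
    qed
    have \<kappa>_nonneg: "0 \<le> \<kappa> \<epsilon> t" if "\<epsilon> \<in> signs N" for \<epsilon> t N
      unfolding \<kappa>_def using that by (intro prod_nonneg riesz_kernel_nonneg ballI) simp
    have monomial_mult: "monomial_at n \<alpha> (\<lambda>i. w i * z i) = monomial_at n \<alpha> w * monomial_at n \<alpha> z" for \<alpha> w z
      by (simp add: monomial_at_def power_mult_distrib prod.distrib)
    have average: "(\<Sum>t\<in>P. \<kappa> \<epsilon> t *\<^sub>R (\<Sum>\<alpha>\<in>?S. monomial_at n \<alpha> (\<lambda>i. \<omega> t i * z i) *\<^sub>C x \<alpha>))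
        = (\<Sum>\<alpha>\<in>?S. ((\<Prod>a\<in>T \<alpha>. \<epsilon> a) * d \<alpha>) *\<^sub>R (monomial_at n \<alpha> z *\<^sub>C x \<alpha>))" for \<epsilon> z
    proof -
      have "(\<Sum>t\<in>P. \<kappa> \<epsilon> t *\<^sub>R (\<Sum>\<alpha>\<in>?S. monomial_at n \<alpha> (\<lambda>i. \<omega> t i * z i) *\<^sub>C x \<alpha>))
          = (\<Sum>\<alpha>\<in>?S. \<Sum>t\<in>P. (of_real (\<kappa> \<epsilon> t) * monomial_at n \<alpha> (\<omega> t)) *\<^sub>C (monomial_at n \<alpha> z *\<^sub>C x \<alpha>))"
        unfolding scaleR_sum_right
        by (subst sum.swap) (simp add: monomial_mult scaleR_scaleC scaleC_scaleC mult.assoc)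
      then show ?thesis
        by (simp add: moment scaleR_scaleC flip: scaleC_sum_left)
    qed
    have "finite (\<Union>(T ` ?S))"
      using T_card by (auto simp: finite_multi_indices)
    then obtain N where "\<Union>(T ` ?S) \<subseteq> {..<N}"
      using finite_nat_iff_bounded by blast
    then have N: "T \<alpha> \<subseteq> {..<N}" if "\<alpha> \<in> ?S" for \<alpha>
      using that by auto
    define H where "H z = sign_avg N (\<lambda>\<epsilon>. \<Sum>t\<in>P. \<kappa> \<epsilon> t * f (\<lambda>i. \<omega> t i * z i))" for z
    have pointwise: "(\<Sum>\<alpha>\<in>?S. norm (x \<alpha>) powr q) \<le> (4 powr q * C powr q) ^ m * H z"
      if z: "\<And>i. i < n \<Longrightarrow> cmod (z i) = 1" for z
    proof -
      \<comment> \<open>Coefficients are transported to sets along the inverse of \<open>T\<close>,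
        together with the weight \<open>d \<alpha>\<close> and the monomial in \<open>z\<close>,
        which has modulus one.\<close>
      define y where "y A = (let \<alpha> = the_inv_into ?S T A in d \<alpha> *\<^sub>R (monomial_at n \<alpha> z *\<^sub>C x \<alpha>))" for A
      have y: "y (T \<alpha>) = d \<alpha> *\<^sub>R (monomial_at n \<alpha> z *\<^sub>C x \<alpha>)" if "\<alpha> \<in> ?S" for \<alpha>
        using that by (simp add: y_def the_inv_into_f_f[OF T_inj])
      let ?g = "\<lambda>\<epsilon>. norm (\<Sum>A\<in>T ` ?S. (\<Prod>i\<in>A. \<epsilon> i) *\<^sub>R y A) powr q"
      have g_eq: "?g \<epsilon> = norm (\<Sum>t\<in>P. \<kappa> \<epsilon> t *\<^sub>R (\<Sum>\<alpha>\<in>?S. monomial_at n \<alpha> (\<lambda>i. \<omega> t i * z i) *\<^sub>C x \<alpha>)) powr q" for \<epsilon>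
        by (simp add: sum.reindex[OF T_inj] y average)
      have "integral\<^sup>L sign_measure ?g = sign_avg N ?g"
        using N
        by (intro integral_sign_measure arg_cong[where f = "\<lambda>v. norm v powr q"] sum.cong refl
          arg_cong2[where f = "(*\<^sub>R)"] prod.cong) auto
      also have "\<dots> \<le> H z"
        unfolding H_def
      proof (rule sign_avg_mono)
        fix \<epsilon> assume \<epsilon>: "\<epsilon> \<in> signs N"
        \<comment> \<open>The kernel is nonnegative with sum one, so Jensen has constant
          one.\<close>
        show "?g \<epsilon> \<le> (\<Sum>t\<in>P. \<kappa> \<epsilon> t * f (\<lambda>i. \<omega> t i * z i))"
          unfolding g_eq
          using norm_weighted_sum_powr_le[OF finP q, of "\<kappa> \<epsilon>"
              "\<lambda>t. \<Sum>\<alpha>\<in>?S. monomial_at n \<alpha> (\<lambda>i. \<omega> t i * z i) *\<^sub>C x \<alpha>"] \<kappa>_nonneg[OF \<epsilon>]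
          by (simp add: \<kappa>_total f_def)
      qed
      finally have le_H: "integral\<^sup>L sign_measure ?g \<le> H z" .
      have "(\<Sum>A\<in>T ` ?S. norm (y A) powr q) \<le> (C powr q) ^ m * integral\<^sup>L sign_measure ?g"
        using ineq[OF m, of "T ` ?S" y] T_card C q finite_multi_indices[of n m]
        by (subst powr_root_le_iff[symmetric]) (auto intro: sum_nonneg)
      also have "\<dots> \<le> (C powr q) ^ m * H z"
        using le_H by (intro mult_left_mono) auto
      finally have 1: "(\<Sum>\<alpha>\<in>?S. norm (y (T \<alpha>)) powr q) \<le> (C powr q) ^ m * H z"
        by (simp add: sum.reindex[OF T_inj])
      have "(\<Sum>\<alpha>\<in>?S. norm (x \<alpha>) powr q) \<le> (\<Sum>\<alpha>\<in>?S. (4 powr q) ^ m * norm (y (T \<alpha>)) powr q)"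
      proof (rule sum_mono)
        fix \<alpha> assume \<alpha>: "\<alpha> \<in> ?S"
        have "1 \<le> 4 ^ m * d \<alpha>"
          using d_ge[OF \<alpha>] by (simp add: power_one_over field_simps)
        then have "norm (x \<alpha>) \<le> 4 ^ m * (d \<alpha> * norm (x \<alpha>))"
          using mult_right_mono[of 1 "4 ^ m * d \<alpha>" "norm (x \<alpha>)"] by (simp add: mult.assoc)
        also have "\<dots> = 4 ^ m * norm (y (T \<alpha>))"
          using \<alpha> d_ge[OF \<alpha>] order_trans[OF _ d_ge[OF \<alpha>], of 0] by (simp add: y norm_scaleC norm_monomial[OF z])
        finally have "norm (x \<alpha>) powr q \<le> (4 ^ m * norm (y (T \<alpha>))) powr q"
          using q by (intro powr_mono2) auto
        also have "\<dots> = (4 powr q) ^ m * norm (y (T \<alpha>)) powr q"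
          by (simp add: powr_mult powr_powr mult.commute flip: powr_realpow)
        finally show "norm (x \<alpha>) powr q \<le> (4 powr q) ^ m * norm (y (T \<alpha>)) powr q" .
      qed
      also have "\<dots> \<le> (4 powr q) ^ m * ((C powr q) ^ m * H z)"
        using 1 by (simp flip: sum_distrib_left add: mult_left_mono)
      finally show ?thesis
        by (simp add: power_mult_distrib mult.assoc)
    qed
    interpret prob_space "torus_measure n" by (rule prob_space_torus_measure)
    have cont: "continuous_on UNIV f"
      unfolding f_def using q by (intro continuous_on_norm_sum_scaleC_powr continuous_on_monomial_at) auto
    have dep: "f z = f z'" if "\<And>i. i < n \<Longrightarrow> z i = z' i" for z z'
      using that by (simp add: f_def monomial_at_def)
    have norm_\<omega>: "cmod (\<omega> t i) = 1" for t i
      by (simp add: \<omega>_def)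
    have integrable_f: "integrable (torus_measure n) (\<lambda>z. f (\<lambda>i. \<omega> t i * z i))" for t
      using q
      by (intro integrable_torus[where B = "(\<Sum>\<alpha>\<in>?S. norm (x \<alpha>)) powr q"] continuous_on_rotate cont)
         (auto simp: f_def norm_monomial norm_mult norm_\<omega> intro!: norm_sum_scaleC_powr_le)
    have integrable_H: "integrable (torus_measure n) H"
      unfolding H_def sign_avg_def using integrable_f by auto
    have "(\<Sum>\<alpha>\<in>?S. norm (x \<alpha>) powr q) = (\<integral>z. (\<Sum>\<alpha>\<in>?S. norm (x \<alpha>) powr q) \<partial>torus_measure n)"
      by (simp add: prob_space)
    also have "\<dots> \<le> (\<integral>z. (4 powr q * C powr q) ^ m * H z \<partial>torus_measure n)"
      using integrable_H
      by (intro integral_mono pointwise) (auto simp: space_torus_measure PiE_iff)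
    also have "\<dots> = (4 powr q * C powr q) ^ m * integral\<^sup>L (torus_measure n) H"
      by simp
    also have "integral\<^sup>L (torus_measure n) H
        = sign_avg N (\<lambda>\<epsilon>. \<Sum>t\<in>P. \<kappa> \<epsilon> t * (\<integral>z. f (\<lambda>i. \<omega> t i * z i) \<partial>torus_measure n))"
      unfolding H_def sign_avg_def using integrable_f by simp
    \<comment> \<open>Each rotation leaves the integral of \<open>f\<close> unchanged, so only the
      total mass of \<open>\<kappa>\<close> remains.\<close>
    also have "\<dots> = sign_avg N (\<lambda>\<epsilon>. \<Sum>t\<in>P. \<kappa> \<epsilon> t * integral\<^sup>L (torus_measure n) f)"
      using integral_torus_rotate[OF cont dep norm_\<omega>] by simp
    also have "\<dots> = integral\<^sup>L (torus_measure n) f"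
      by (simp add: \<kappa>_total flip: sum_distrib_right)
    finally show "(\<Sum>\<alpha>\<in>?S. norm (x \<alpha>) powr q) powr (1 / q)
        \<le> (4 * C) ^ m * (\<integral>z. norm (\<Sum>\<alpha>\<in>?S. monomial_at n \<alpha> z *\<^sub>C x \<alpha>) powr q \<partial>torus_measure n) powr (1 / q)"
      using C q by (subst powr_root_le_iff) (auto simp: f_def[abs_def] powr_mult intro: sum_nonneg)
  qed
qed

subsection \<open>From polynomials on the torus to cotype\<close>

lemma torus_cotype_imp_cotype:
  fixes q :: real
  assumes q: "1 \<le> q"
    and torus: "\<exists>C>0. \<forall>m\<ge>1. \<forall>n. \<forall>x :: (nat \<Rightarrow> nat) \<Rightarrow> 'a::complex_banach.
        (\<Sum>\<alpha>\<in>multi_indices n m. norm (x \<alpha>) powr q) powr (1 / q)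
          \<le> C ^ m * (\<integral>z. norm (\<Sum>\<alpha>\<in>multi_indices n m. monomial_at n \<alpha> z *\<^sub>C x \<alpha>) powr q
                        \<partial>torus_measure n) powr (1 / q)" (is "\<exists>C>0. ?P C")
  shows "cotype q TYPE('a)"
proof -
  obtain C where C: "C > 0" and P: "?P C"
    using torus by blast
  have ineq: "(\<Sum>\<alpha>\<in>multi_indices n 1. norm (x \<alpha>) powr q) powr (1 / q)
        \<le> C * (\<integral>z. norm (\<Sum>\<alpha>\<in>multi_indices n 1. monomial_at n \<alpha> z *\<^sub>C x \<alpha>) powr q
                      \<partial>torus_measure n) powr (1 / q)" for n and x :: "(nat \<Rightarrow> nat) \<Rightarrow> 'a"
    using P[THEN spec[of _ 1]] by simp
  show ?thesis
    unfolding cotype_def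
  \<comment> \<open>The definition of cotype asks for a constant that is at least
    \<open>1\<close>.\<close>
  proof (intro exI[of _ "max 1 C"] conjI allI)
    fix N and x :: "nat \<Rightarrow> 'a"
    define e where "e k = (\<lambda>i :: nat. if i = k then 1 else 0 :: nat)" for k
    \<comment> \<open>Only the unit multi-indices carry a coefficient; the constant term, also of
      degree at most one, receives \<open>0\<close>.\<close>
    define y where "y \<alpha> = (if \<alpha> \<in> e ` {..<N} then x (the_inv_into {..<N} e \<alpha>) else 0)" for \<alpha>
    have inj: "inj_on e {..<N}"
      by (intro inj_onI) (metis e_def zero_neq_one)
    have sum_eq: "(\<Sum>\<alpha>\<in>multi_indices N 1. h \<alpha> (y \<alpha>)) = (\<Sum>k<N. h (e k) (x k))"
      if "\<And>\<alpha>. h \<alpha> 0 = 0" for h :: "(nat \<Rightarrow> nat) \<Rightarrow> 'a \<Rightarrow> 'b::comm_monoid_add"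
    proof -
      have "e ` {..<N} \<subseteq> multi_indices N 1"
        by (auto simp: multi_indices_def e_def)
      then have "(\<Sum>\<alpha>\<in>multi_indices N 1. h \<alpha> (y \<alpha>)) = (\<Sum>\<alpha>\<in>e ` {..<N}. h \<alpha> (y \<alpha>))"
        using that by (intro sum.mono_neutral_right finite_multi_indices) (auto simp: y_def)
      also have "\<dots> = (\<Sum>k<N. h (e k) (x k))"
        by (simp add: sum.reindex[OF inj] y_def the_inv_into_f_f[OF inj])
      finally show ?thesis .
    qed
    have monomial: "monomial_at N (e k) z = z k" if "k < N" for k z
    proof -
      have "monomial_at N (e k) z = (\<Prod>i<N. if i = k then z i else 1)"
        unfolding monomial_at_def by (intro prod.cong) (auto simp: e_def)
      then show ?thesis
        using that by (simp add: prod.delta)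
    qed
    have "(\<Sum>k<N. norm (x k) powr q) powr (1 / q)
        \<le> C * (\<integral>z. norm (\<Sum>k<N. z k *\<^sub>C x k) powr q \<partial>torus_measure N) powr (1 / q)"
      using ineq[where n = N and x = y] sum_eq[of "\<lambda>_ v. norm v powr q"] sum_eq[of "\<lambda>\<alpha> v. monomial_at N \<alpha> _ *\<^sub>C v"] q
      by (simp add: scaleC_zero_right monomial)
    also have "\<dots> \<le> max 1 C * (\<integral>z. norm (\<Sum>k<N. z k *\<^sub>C x k) powr q \<partial>torus_measure N) powr (1 / q)"
      by (intro mult_right_mono) auto
    finally show "(\<Sum>k<N. norm (x k) powr q) powr (1 / q)
        \<le> max 1 C * (\<integral>z. norm (\<Sum>k<N. z k *\<^sub>C x k) powr q \<partial>torus_measure N) powr (1 / q)" .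
  qed simp
qed

theorem theorem3p1:
  fixes q :: real
  assumes "2 \<le> q"
  defines "a \<equiv> cotype q TYPE('a::complex_banach)"
  defines "b \<equiv> (\<exists>C>0. \<forall>m\<ge>1. \<forall>n. \<forall>x :: (nat \<Rightarrow> nat) \<Rightarrow> 'a.
        (\<Sum>\<alpha>\<in>multi_indices n m. norm (x \<alpha>) powr q) powr (1 / q)
          \<le> C ^ m * (\<integral>z. norm (\<Sum>\<alpha>\<in>multi_indices n m. monomial_at n \<alpha> z *\<^sub>C x \<alpha>) powr q
                        \<partial>torus_measure n) powr (1 / q))"
  defines "c \<equiv> (\<exists>C>0. \<forall>m\<ge>1. \<forall>F. \<forall>x :: nat set \<Rightarrow> 'a.
        finite F \<and> (\<forall>A\<in>F. finite A \<and> card A \<le> m) \<longrightarrow>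
        (\<Sum>A\<in>F. norm (x A) powr q) powr (1 / q)
          \<le> C ^ m * (\<integral>\<epsilon>. norm (\<Sum>A\<in>F. (\<Prod>i\<in>A. \<epsilon> i) *\<^sub>R x A) powr q
                        \<partial>sign_measure) powr (1 / q))"
  shows "(a \<longleftrightarrow> b) \<and> (b \<longleftrightarrow> c)"
proof -
  have q: "1 \<le> q" using assms(1) by simp
  have "a \<Longrightarrow> c"
    unfolding a_def c_def by (rule cotype_imp_walsh_cotype[OF q])
  moreover have "c \<Longrightarrow> b"
    unfolding b_def c_def by (rule walsh_imp_torus_cotype[OF q])
  moreover have "b \<Longrightarrow> a"
    unfolding a_def b_def by (rule torus_cotype_imp_cotype[OF q])
  ultimately show ?thesis by blast
qed

end
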